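(* Let $a<b$, $A,B$ be real numbers and let $L\in C([a,b]\times\mathbb{R}\times\mathbb{R})$ satisfy: (i) for each compact $G\subset[a,b]\times\mathbb{R}\times\mathbb{R}$ there exist $C>0$ and $\alpha>0$ such that $|L(x_1,u_1,v_1)-L(x_2,u_2,v_2)|\le C(|x_1-x_2|+|u_1-u_2|+|v_1-v_2|)^{\alpha}$ for all $(x_1,u_1,v_1),(x_2,u_2,v_2)\in G$; (ii) $L_{vv}\in C([a,b]\times\mathbb{R}\times\mathbb{R})$ and there exists $\mu>0$ such that $L_{vv}\ge\mu$ everywhere. Let $f,g\in C^{1,\sigma}([a,b])$ (for some Hölder exponent $\sigma\in]0,1]$) with $f<g$. Then every $u\in\mathcal{A}_{f,g}$ such that $\mathcal{J}_L(u;[a,b])\le\mathcal{J}_L(v;[a,b])$ for all $v\in\mathcal{A}_{f,g}$ has Tonelli's partial regularity.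
   Context: $L=L(x,u,v)$; $L_{vv}$ is the second partial derivative in $v$. Functions in $W^{1,1}([a,b])$ are identified with their absolutely continuous representatives. $\mathcal{J}_L(u;[a,b]):=\int_a^bL(x,u(x),u'(x))\,dx$ and $$\mathcal{A}_{f,g}:=\{u\in W^{1,1}([a,b]):u(a)=A,\ u(b)=B,\ f\le u\le g\}.$$ $C^{1,\sigma}([a,b])$ is the space of $C^1$ functions on $[a,b]$ whose derivative is $\sigma$-Hölder continuous. Tonelli's partial regularity. For $u\in W^{1,1}([a,b])$ let $\Omega_u:=\{x\in[a,b]:u\text{ is differentiable at }x\}$ (finite derivative, one-sided at $a$ and $b$). $u$ has Tonelli's partial regularity if: $\Omega_u$ is an open subset of $[a,b]$; $[a,b]\setminus\Omega_u=\{x\in[a,b]:u'(x)=-\infty\text{ or }u'(x)=\infty\}$; and $u'\in C([a,b];[-\infty,\infty])$. *)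

theory Defs
  imports "HOL-Analysis.Analysis"
begin

text \<open>
  Functions on \<open>[a, b]\<close> are total functions \<open>real \<Rightarrow> real\<close>; no notion below depends on their
  values outside \<open>[a, b]\<close>.
\<close>

definition test_functions :: "real \<Rightarrow> real \<Rightarrow> (real \<Rightarrow> real) set" where
  "test_functions a b =
     {\<phi>. \<phi> C1_differentiable_on UNIV \<and>
          compact (closure {x. \<phi> x \<noteq> 0}) \<and> closure {x. \<phi> x \<noteq> 0} \<subseteq> {a<..<b}}"

definition has_weak_derivative :: "(real \<Rightarrow> real) \<Rightarrow> (real \<Rightarrow> real) \<Rightarrow> real \<Rightarrow> real \<Rightarrow> bool" where
  "has_weak_derivative u w a b \<longleftrightarrow>
     set_integrable lebesgue {a..b} u \<and> set_integrable lebesgue {a..b} w \<and>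
     (\<forall>\<phi>\<in>test_functions a b.
        (LINT x:{a..b}|lebesgue. u x * deriv \<phi> x) = - (LINT x:{a..b}|lebesgue. w x * \<phi> x))"

text \<open>
  A \<open>division_of\<close> is a finite set of compact intervals with disjoint interiors; the
  set \<open>S\<close> is their union, so the divisions range over all finite families of non-overlapping
  compact subintervals of \<open>[a, b]\<close>.
\<close>

definition abs_continuous_on_interval :: "(real \<Rightarrow> real) \<Rightarrow> real \<Rightarrow> real \<Rightarrow> bool" where
  "abs_continuous_on_interval u a b \<longleftrightarrow>
     (\<forall>\<epsilon>>0. \<exists>\<delta>>0. \<forall>D S. D division_of S \<and> S \<subseteq> {a..b} \<and> (\<Sum>K\<in>D. Sup K - Inf K) < \<delta> \<longrightarrow>
        (\<Sum>K\<in>D. \<bar>u (Sup K) - u (Inf K)\<bar>) < \<epsilon>)"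

text \<open>
  Each Sobolev class is represented by its absolutely continuous member.
\<close>

definition W11 :: "real \<Rightarrow> real \<Rightarrow> (real \<Rightarrow> real) set" where
  "W11 a b = {u. abs_continuous_on_interval u a b \<and> (\<exists>w. has_weak_derivative u w a b)}"

text \<open>
  The weak derivative is unique up to a null set, so the choice does not affect integrals.
\<close>

definition weak_derivative :: "(real \<Rightarrow> real) \<Rightarrow> real \<Rightarrow> real \<Rightarrow> real \<Rightarrow> real" where
  "weak_derivative u a b = (SOME w. has_weak_derivative u w a b)"

text \<open>
  The functional may take the value \<open>\<infinity>\<close>, hence it is the difference of the integrals of
  the positive and the negative part (\<open>ennreal\<close> maps negative numbers to \<open>0\<close>). If \<open>L\<close> is
  continuous and uniformly convex in its last argument, then the second integral is finite
  for every \<open>u\<close> in \<open>W11 a b\<close>, so that \<open>\<infinity> - \<infinity>\<close> does not occur.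
\<close>

definition action :: "(real \<Rightarrow> real \<Rightarrow> real \<Rightarrow> real) \<Rightarrow> (real \<Rightarrow> real) \<Rightarrow> real \<Rightarrow> real \<Rightarrow> ereal" where
  "action L u a b =
     enn2ereal (\<integral>\<^sup>+x\<in>{a..b}. ennreal (L x (u x) (weak_derivative u a b x)) \<partial>lebesgue)
     - enn2ereal (\<integral>\<^sup>+x\<in>{a..b}. ennreal (- L x (u x) (weak_derivative u a b x)) \<partial>lebesgue)"

definition admissible ::
    "real \<Rightarrow> real \<Rightarrow> real \<Rightarrow> real \<Rightarrow> (real \<Rightarrow> real) \<Rightarrow> (real \<Rightarrow> real) \<Rightarrow> (real \<Rightarrow> real) set" where
  "admissible a b A B f g =
     {u \<in> W11 a b. u a = A \<and> u b = B \<and> (\<forall>x\<in>{a..b}. f x \<le> u x \<and> u x \<le> g x)}"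

definition C1_Holder :: "real \<Rightarrow> real \<Rightarrow> real \<Rightarrow> (real \<Rightarrow> real) set" where
  "C1_Holder \<sigma> a b =
     {f. \<exists>f'. (\<forall>x\<in>{a..b}. (f has_real_derivative f' x) (at x within {a..b})) \<and>
              continuous_on {a..b} f' \<and>
              (\<exists>C. \<forall>x\<in>{a..b}. \<forall>y\<in>{a..b}. \<bar>f' x - f' y\<bar> \<le> C * \<bar>x - y\<bar> powr \<sigma>)}"

definition locally_Holder_lagrangian ::
    "(real \<Rightarrow> real \<Rightarrow> real \<Rightarrow> real) \<Rightarrow> real \<Rightarrow> real \<Rightarrow> bool" where
  "locally_Holder_lagrangian L a b \<longleftrightarrow>
     (\<forall>G. compact G \<and> G \<subseteq> {a..b} \<times> UNIV \<times> UNIV \<longrightarrow>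
        (\<exists>C>0. \<exists>\<alpha>>0. \<forall>(x1, u1, v1)\<in>G. \<forall>(x2, u2, v2)\<in>G.
           \<bar>L x1 u1 v1 - L x2 u2 v2\<bar> \<le> C * (\<bar>x1 - x2\<bar> + \<bar>u1 - u2\<bar> + \<bar>v1 - v2\<bar>) powr \<alpha>))"

definition L_vv :: "(real \<Rightarrow> real \<Rightarrow> real \<Rightarrow> real) \<Rightarrow> real \<Rightarrow> real \<Rightarrow> real \<Rightarrow> real" where
  "L_vv L x u v = deriv (deriv (L x u)) v"

text \<open>
  The existence of the derivatives is stated explicitly because \<open>deriv\<close> is total.
\<close>

definition has_continuous_L_vv :: "(real \<Rightarrow> real \<Rightarrow> real \<Rightarrow> real) \<Rightarrow> real \<Rightarrow> real \<Rightarrow> bool" where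
  "has_continuous_L_vv L a b \<longleftrightarrow>
     (\<forall>x\<in>{a..b}. \<forall>u v. L x u field_differentiable (at v) \<and>
                      deriv (L x u) field_differentiable (at v)) \<and>
     continuous_on ({a..b} \<times> UNIV \<times> UNIV) (\<lambda>(x, u, v). L_vv L x u v)"

text \<open>
  Classical derivatives on \<open>[a, b]\<close>, one-sided at the end points, with values in
  \<open>[-\<infinity>, \<infinity>]\<close>.
\<close>

definition has_ext_derivative ::
    "(real \<Rightarrow> real) \<Rightarrow> ereal \<Rightarrow> real \<Rightarrow> real \<Rightarrow> real \<Rightarrow> bool" where
  "has_ext_derivative u d a b x \<longleftrightarrow>
     ((\<lambda>y. ereal ((u y - u x) / (y - x))) \<longlongrightarrow> d) (at x within {a..b})"

definition ext_derivative :: "(real \<Rightarrow> real) \<Rightarrow> real \<Rightarrow> real \<Rightarrow> real \<Rightarrow> ereal" where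
  "ext_derivative u a b x = (THE d. has_ext_derivative u d a b x)"

definition differentiability_set :: "(real \<Rightarrow> real) \<Rightarrow> real \<Rightarrow> real \<Rightarrow> real set" where
  "differentiability_set u a b = {x \<in> {a..b}. u differentiable (at x within {a..b})}"

definition tonelli_partial_regularity :: "(real \<Rightarrow> real) \<Rightarrow> real \<Rightarrow> real \<Rightarrow> bool" where
  "tonelli_partial_regularity u a b \<longleftrightarrow>
     openin (top_of_set {a..b}) (differentiability_set u a b) \<and>
     {a..b} - differentiability_set u a b =
       {x \<in> {a..b}. has_ext_derivative u (-\<infinity>) a b x \<or> has_ext_derivative u \<infinity> a b x} \<and>
     continuous_on {a..b} (ext_derivative u a b)"

end

theory Submission
  imports Defs
begin

text \<open>
  On an interval \<open>[x1, x2]\<close> of length \<open>h\<close> on which \<open>u\<close> has slope \<open>s\<close> with \<open>\<bar>s\<bar> \<le> M\<close>, compare \<open>u\<close> with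
  an obstacle-respecting \<open>C^1\<close> curve with the same end points and derivative \<open>s + O(h powr \<sigma>)\<close>. Freezing
  the first two arguments of \<open>L\<close> at \<open>(x1, u x1)\<close> costs a Hoelder error, the linear terms
  integrate to the same value for both curves, and uniform convexity bounds the integral of
  \<open>(u' - s)^2\<close> by \<open>C * h powr (1 + 2 * \<gamma>)\<close>; hence \<open>u\<close> deviates from its chord by at most
  \<open>C * h powr (1 + \<gamma>)\<close>. Iterating over shrinking intervals, all slopes of \<open>u\<close> inside a short
  interval of bounded slope are close to that slope. By continuity, slopes cannot pass from one
  value to another on nested short intervals without violating this rigidity; so the
  difference quotients converge in \<open>[-\<infinity>, \<infinity>]\<close>, and the limit depends continuously on the point.
\<close>

section \<open>Rigidity of slopes\<close>

text \<open>\<open>L\<close> is only Hoelder continuous in \<open>(x, u)\<close>, so there is no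
  Euler-Lagrange equation to work with, and \<open>u'\<close> is a priori only integrable. The upper
  bound is applied only to the competitor, whose velocity is bounded, so local bounds on
  \<open>L_vv\<close> suffice there. All constants depend on the bound \<open>M\<close> for the
  ambient slope, and nothing is estimated directly on steep intervals. Infinite derivatives come
  from an exclusion argument: between a steep interval and a much flatter one inside it lies an
  interval of moderate slope, and to that one rigidity applies. The exponent is
  \<open>\<gamma> = min (\<alpha> / 2) \<sigma>\<close>: the Hoelder error enters the energy with
  exponent \<open>\<alpha>\<close>, the oscillation of the competitor's derivative with exponent
  \<open>2 * \<sigma>\<close>, and the deviation from the chord is governed by the square root of
  the energy.\<close>

definition slope :: "(real \<Rightarrow> real) \<Rightarrow> real \<Rightarrow> real \<Rightarrow> real" where
  "slope u x y = (u y - u x) / (y - x)"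

lemma slope_commute: "slope u x y = slope u y x"
  unfolding slope_def by (metis minus_diff_eq minus_divide_divide)

lemma slope_uminus: "slope (\<lambda>x. - u x) x y = - slope u x y"
  unfolding slope_def by (simp add: divide_simps)

lemma slope_eqD: "x \<noteq> y \<Longrightarrow> u y - u x = slope u x y * (y - x)"
  unfolding slope_def by simp

text \<open>The bound \<open>M\<close> restricts the ambient interval only, and the inner interval
  may be arbitrarily short. Hence a short interval of moderate slope contains no steep chord at any
  scale.\<close>

definition slope_rigid :: "(real \<Rightarrow> real) \<Rightarrow> real \<Rightarrow> real \<Rightarrow> bool" where
  "slope_rigid u a b \<longleftrightarrow>
     (\<forall>M. \<forall>\<eta>>0. \<exists>\<epsilon>>0. \<forall>x1 y1 y2 x2.
        a \<le> x1 \<and> x1 \<le> y1 \<and> y1 < y2 \<and> y2 \<le> x2 \<and> x2 \<le> b \<and> x2 - x1 \<le> \<epsilon> \<and> \<bar>slope u x1 x2\<bar> \<le> M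
          \<longrightarrow> \<bar>slope u y1 y2 - slope u x1 x2\<bar> \<le> \<eta>)"

lemma slope_rigid_uminus: "slope_rigid u a b \<Longrightarrow> slope_rigid (\<lambda>x. - u x) a b"
  unfolding slope_rigid_def slope_uminus abs_minus_cancel
  by (metis (no_types, lifting) abs_minus_commute diff_minus_eq_add add.commute uminus_add_conv_diff)

lemma continuous_on_slope:
  assumes "continuous_on S u" "continuous_on T p" "continuous_on T q"
    and "p ` T \<subseteq> S" "q ` T \<subseteq> S" "\<And>t. t \<in> T \<Longrightarrow> p t \<noteq> q t"
  shows "continuous_on T (\<lambda>t. slope u (p t) (q t))"
  unfolding slope_def
  by (intro continuous_intros continuous_on_compose2[OF assms(1)] assms) (use assms in force)

text \<open>
  A subinterval of smaller slope can be enlarged continuously until its slope takes a value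
  strictly between \<open>c'\<close> and \<open>c\<close>; rigidity forbids the jump back to the small slope.
\<close>

lemma slope_ge_of_subinterval:
  assumes rigid: "\<And>x1 y1 y2 x2. \<lbrakk>a \<le> x1; x1 \<le> y1; y1 < y2; y2 \<le> x2; x2 \<le> b; x2 - x1 \<le> \<epsilon>;
      \<bar>slope u x1 x2\<bar> \<le> M\<rbrakk> \<Longrightarrow> \<bar>slope u y1 y2 - slope u x1 x2\<bar> \<le> (c - c') / 4"
    and cont: "continuous_on {a..b} u" and c: "c' < c" "\<bar>c\<bar> \<le> M" "\<bar>c'\<bar> \<le> M"
    and J: "a \<le> p" "q \<le> b" "q - p \<le> \<epsilon>" "slope u p q > c"
    and I: "p \<le> y1" "y1 < y2" "y2 \<le> q"
  shows "slope u y1 y2 \<ge> c'"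
proof (rule ccontr)
  assume neg: "\<not> ?thesis"
  define l where "l t = y1 + t * (p - y1)" for t
  define r where "r t = y2 + t * (q - y2)" for t
  have l: "p \<le> l t \<and> l t \<le> y1" if "t \<in> {0..1}" for t
  proof -
    have "t * (y1 - p) \<le> y1 - p" "0 \<le> t * (y1 - p)"
      using that I mult_right_mono[of t 1 "y1 - p"] by simp_all
    then show ?thesis by (auto simp: l_def algebra_simps)
  qed
  have r: "y2 \<le> r t \<and> r t \<le> q" if "t \<in> {0..1}" for t
  proof -
    have "t * (q - y2) \<le> q - y2" "0 \<le> t * (q - y2)"
      using that I mult_right_mono[of t 1 "q - y2"] by simp_all
    then show ?thesis by (auto simp: r_def algebra_simps)
  qed
  have cs: "continuous_on {0..1} (\<lambda>t. slope u (l t) (r t))"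
  proof (rule continuous_on_slope[OF cont])
    show "continuous_on {0..1} l" "continuous_on {0..1} r"
      unfolding l_def r_def by (intro continuous_intros)+
    show "l ` {0..1} \<subseteq> {a..b}" "r ` {0..1} \<subseteq> {a..b}"
      using l r I J by force+
    show "l t \<noteq> r t" if "t \<in> {0..1}" for t
      using l[OF that] r[OF that] I by auto
  qed
  have "\<exists>t\<ge>0. t \<le> 1 \<and> slope u (l t) (r t) = (c + c') / 2"
    by (rule IVT') (use neg J c cs in \<open>auto simp: l_def r_def\<close>)
  then obtain t where t: "t \<in> {0..1}" "slope u (l t) (r t) = (c + c') / 2" by auto
  \<comment> \<open>Rigidity is used on the intermediate interval, because the slope over
    \<open>{p..q}\<close> may exceed \<open>M\<close>. Its slope \<open>(c + c') / 2\<close> exceeds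
    \<open>c'\<close> by twice the tolerance.\<close>
  have "\<bar>slope u y1 y2 - slope u (l t) (r t)\<bar> \<le> (c - c') / 4"
    by (rule rigid) (use l[OF t(1)] r[OF t(1)] I J c t(2) in auto)
  then show False using neg c t(2) by (auto simp: field_simps)
qed

text \<open>A single steep chord from \<open>x\<close> to a close point \<open>y\<close> suffices.
  By continuity of \<open>u\<close> its end at \<open>x\<close> can be pushed slightly to the other
  side of \<open>x\<close> while the chord stays steep; the interval obtained contains a
  neighbourhood of \<open>x\<close> in \<open>{a..b}\<close>, and
  \<open>slope_ge_of_subinterval\<close> controls every slope inside it.\<close>

lemma slope_ge_nhd:
  assumes rigid: "slope_rigid u a b" and cont: "continuous_on {a..b} u"
    and x: "x \<in> {a..b}" and c: "c' < c"
    and freq: "\<exists>\<^sub>F y in at x within {a..b}. slope u x y > c"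
  shows "\<exists>\<delta>>0. \<forall>y1 y2. y1 \<in> {a..b} \<and> y2 \<in> {a..b} \<and> \<bar>y1 - x\<bar> < \<delta> \<and> \<bar>y2 - x\<bar> < \<delta> \<and> y1 \<noteq> y2 \<longrightarrow>
           slope u y1 y2 \<ge> c'"
proof -
  define M where "M = \<bar>c\<bar> + \<bar>c'\<bar>"
  have "(c - c') / 4 > 0" using c by simp
  with rigid obtain \<epsilon> where \<epsilon>: "\<epsilon> > 0" and "\<forall>x1 y1 y2 x2. a \<le> x1 \<and> x1 \<le> y1 \<and> y1 < y2 \<and> y2 \<le> x2 \<and>
      x2 \<le> b \<and> x2 - x1 \<le> \<epsilon> \<and> \<bar>slope u x1 x2\<bar> \<le> M \<longrightarrow>
      \<bar>slope u y1 y2 - slope u x1 x2\<bar> \<le> (c - c') / 4"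
    unfolding slope_rigid_def by meson
  then have rig: "\<bar>slope u y1 y2 - slope u x1 x2\<bar> \<le> (c - c') / 4"
    if "a \<le> x1" "x1 \<le> y1" "y1 < y2" "y2 \<le> x2" "x2 \<le> b" "x2 - x1 \<le> \<epsilon>" "\<bar>slope u x1 x2\<bar> \<le> M"
    for x1 y1 y2 x2
    using that by blast
  have "\<exists>\<^sub>F y in at x within {a..b}. slope u x y > c \<and> y \<in> {a..b} \<and> y \<noteq> x \<and> \<bar>y - x\<bar> < \<epsilon> / 2"
  proof -
    have "\<forall>\<^sub>F y in at x within {a..b}. y \<in> {a..b} \<and> y \<noteq> x \<and> \<bar>y - x\<bar> < \<epsilon> / 2"
      unfolding eventually_at by (intro exI[of _ "\<epsilon> / 2"]) (use \<epsilon> in \<open>auto simp: dist_real_def\<close>)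
    with freq show ?thesis
      by (rule frequently_rev_mp[OF _ eventually_mono]) auto
  qed
  then obtain y where y: "slope u x y > c" "y \<in> {a..b}" "y \<noteq> x" "\<bar>y - x\<bar> < \<epsilon> / 2"
    by (auto dest: frequently_ex)
  have cs: "continuous_on ({a..b} - {y}) (\<lambda>z. slope u z y)"
    by (rule continuous_on_slope[OF cont]) (use y in \<open>auto intro!: continuous_intros\<close>)
  then have "continuous (at x within {a..b} - {y}) (\<lambda>z. slope u z y)"
    using x y by (auto simp: continuous_on_eq_continuous_within)
  then have "\<forall>\<^sub>F z in at x within ({a..b} - {y}). slope u z y > c"
    using y(1) by (auto simp: continuous_within intro: order_tendstoD)
  then obtain d where d: "d > 0" "\<And>z. z \<in> {a..b} - {y} \<Longrightarrow> z \<noteq> x \<Longrightarrow> \<bar>z - x\<bar> < d \<Longrightarrow> slope u z y > c"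
    unfolding eventually_at by (auto simp: dist_real_def)
  \<comment> \<open>The three bounds keep the pushed chord steep, its length at most
    \<open>\<epsilon>\<close>, and \<open>y\<close> outside the neighbourhood of
    \<open>x\<close>.\<close>
  define \<tau> where "\<tau> = min (d / 2) (min (\<epsilon> / 2) (\<bar>y - x\<bar> / 2))"
  have \<tau>: "\<tau> > 0" "\<tau> < d" "\<tau> \<le> \<epsilon> / 2" "\<tau> < \<bar>y - x\<bar>"
  proof -
    have "\<bar>y - x\<bar> > 0" using y by simp
    then show "\<tau> > 0" "\<tau> < d" "\<tau> \<le> \<epsilon> / 2" "\<tau> < \<bar>y - x\<bar>"
      using d(1) \<epsilon> unfolding \<tau>_def by (auto simp: min_def)
  qed
  have near: "slope u z y > c" if "z \<in> {a..b}" "\<bar>z - x\<bar> \<le> \<tau>" for z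
    using that d(2)[of z] y \<tau> by (cases "z = x") auto
  have main: "slope u y1 y2 \<ge> c'"
    if "y1 \<in> {a..b}" "y2 \<in> {a..b}" "\<bar>y1 - x\<bar> < \<tau>" "\<bar>y2 - x\<bar> < \<tau>" "y1 < y2" for y1 y2
  proof (cases "x < y")
    case True
    show ?thesis
    proof (rule slope_ge_of_subinterval[where p = "max a (x - \<tau>)" and q = y, OF rig cont c])
      show "c < slope u (max a (x - \<tau>)) y"
        by (rule near) (use x \<tau> in \<open>auto simp: max_def\<close>)
    qed (use True that x y \<tau> in \<open>auto simp: M_def\<close>)
  next
    case False
    show ?thesis
    proof (rule slope_ge_of_subinterval[where p = y and q = "min b (x + \<tau>)", OF rig cont c])
      show "c < slope u y (min b (x + \<tau>))"
        unfolding slope_commute[of u y]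
        by (rule near) (use x \<tau> in \<open>auto simp: min_def\<close>)
    qed (use False that x y \<tau> in \<open>auto simp: M_def\<close>)
  qed
  show ?thesis
    by (rule exI[of _ \<tau>]) (metis main \<tau>(1) linorder_neqE slope_commute)
qed

section \<open>Existence and continuity of the extended derivative\<close>

definition upper_slope :: "(real \<Rightarrow> real) \<Rightarrow> real \<Rightarrow> real \<Rightarrow> real \<Rightarrow> ereal" where
  "upper_slope u a b x = Limsup (at x within {a..b}) (\<lambda>y. ereal (slope u x y))"

text \<open>The bound covers all chords near \<open>x\<close>. Those that start at \<open>x\<close>
  give the existence of the derivative there; the others give its lower semicontinuity.\<close>

lemma upper_slope_nhd:
  assumes "slope_rigid u a b" "continuous_on {a..b} u" "x \<in> {a..b}" "l < upper_slope u a b x"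
  shows "\<exists>c'. l < ereal c' \<and> (\<exists>\<delta>>0. \<forall>y1 y2. y1 \<in> {a..b} \<and> y2 \<in> {a..b} \<and>
           \<bar>y1 - x\<bar> < \<delta> \<and> \<bar>y2 - x\<bar> < \<delta> \<and> y1 \<noteq> y2 \<longrightarrow> slope u y1 y2 \<ge> c')"
proof -
  obtain c where c: "l < ereal c" "ereal c < upper_slope u a b x"
    using ereal_dense2[OF assms(4)] by auto
  obtain c' where c': "l < ereal c'" "c' < c"
    using ereal_dense2[OF c(1)] by auto
  have "\<exists>\<^sub>F y in at x within {a..b}. slope u x y > c"
  proof (rule ccontr)
    assume "\<not> ?thesis"
    then have "\<forall>\<^sub>F y in at x within {a..b}. ereal (slope u x y) \<le> ereal c"
      by (simp add: not_frequently not_less)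
    then have "upper_slope u a b x \<le> ereal c"
      unfolding upper_slope_def by (rule Limsup_bounded)
    then show False using c by simp
  qed
  from slope_ge_nhd[OF assms(1-3) c'(2) this] c'(1) show ?thesis by blast
qed

lemma at_within_Icc_nontrivial:
  fixes x :: real
  shows "a < b \<Longrightarrow> x \<in> {a..b} \<Longrightarrow> at x within {a..b} \<noteq> bot"
  by (simp add: trivial_limit_within islimpt_Icc)

lemma has_ext_derivative_iff:
  "has_ext_derivative u d a b x \<longleftrightarrow> ((\<lambda>y. ereal (slope u x y)) \<longlongrightarrow> d) (at x within {a..b})"
  unfolding has_ext_derivative_def slope_def ..

lemma eventually_at_within_Icc:
  fixes x :: real
  assumes "\<delta> > 0" "\<And>y. y \<in> {a..b} \<Longrightarrow> \<bar>y - x\<bar> < \<delta> \<Longrightarrow> y \<noteq> x \<Longrightarrow> P y"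
  shows "\<forall>\<^sub>F y in at x within {a..b}. P y"
  unfolding eventually_at using assms by (auto simp: dist_real_def)

text \<open>The upper limit always exists in \<open>ereal\<close> and bounds the difference
  quotients from above by its definition, so rigidity has to supply only the lower half of the
  convergence.\<close>

lemma has_ext_derivative_upper_slope:
  assumes "slope_rigid u a b" "continuous_on {a..b} u" "x \<in> {a..b}"
  shows "has_ext_derivative u (upper_slope u a b x) a b x"
  unfolding has_ext_derivative_iff
proof (rule order_tendstoI)
  fix l assume "l < upper_slope u a b x"
  from upper_slope_nhd[OF assms this] obtain c \<delta> where c: "l < ereal c" "\<delta> > 0"
    "\<And>y1 y2. y1 \<in> {a..b} \<Longrightarrow> y2 \<in> {a..b} \<Longrightarrow> \<bar>y1 - x\<bar> < \<delta> \<Longrightarrow> \<bar>y2 - x\<bar> < \<delta> \<Longrightarrow> y1 \<noteq> y2 \<Longrightarrow>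
       slope u y1 y2 \<ge> c" by blast
  show "\<forall>\<^sub>F y in at x within {a..b}. l < ereal (slope u x y)"
  proof (rule eventually_at_within_Icc[OF c(2)])
    fix y assume "y \<in> {a..b}" "\<bar>y - x\<bar> < \<delta>" "y \<noteq> x"
    then have "slope u x y \<ge> c" using c(2,3) assms(3) by auto
    then show "l < ereal (slope u x y)" using c(1) by (meson ereal_less_eq(3) order_less_le_trans)
  qed
next
  fix l assume "upper_slope u a b x < l"
  then show "\<forall>\<^sub>F y in at x within {a..b}. ereal (slope u x y) < l"
    unfolding upper_slope_def by (rule Limsup_lessD)
qed

lemma has_ext_derivative_unique:
  assumes "a < b" "x \<in> {a..b}" "has_ext_derivative u d a b x" "has_ext_derivative u d' a b x"
  shows "d = d'"
  using assms tendsto_unique at_within_Icc_nontrivial unfolding has_ext_derivative_def by blast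

lemma ext_derivative_eq:
  assumes "a < b" "x \<in> {a..b}" "has_ext_derivative u d a b x"
  shows "ext_derivative u a b x = d"
  unfolding ext_derivative_def using assms has_ext_derivative_unique by blast

lemma ext_derivative_lsc:
  assumes "a < b" "slope_rigid u a b" "continuous_on {a..b} u" "x \<in> {a..b}" "l < ext_derivative u a b x"
  shows "\<forall>\<^sub>F t in at x within {a..b}. l < ext_derivative u a b t"
proof -
  have D: "ext_derivative u a b t = upper_slope u a b t" if "t \<in> {a..b}" for t
    by (rule ext_derivative_eq[OF assms(1) that has_ext_derivative_upper_slope[OF assms(2,3) that]])
  have "l < upper_slope u a b x" using assms(5) D[OF assms(4)] by simp
  from upper_slope_nhd[OF assms(2,3,4) this] obtain c \<delta> where c: "l < ereal c" "\<delta> > 0"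
    "\<And>y1 y2. y1 \<in> {a..b} \<Longrightarrow> y2 \<in> {a..b} \<Longrightarrow> \<bar>y1 - x\<bar> < \<delta> \<Longrightarrow> \<bar>y2 - x\<bar> < \<delta> \<Longrightarrow> y1 \<noteq> y2 \<Longrightarrow>
       slope u y1 y2 \<ge> c" by blast
  show ?thesis
  proof (rule eventually_at_within_Icc[OF c(2)])
    fix t assume t: "t \<in> {a..b}" "\<bar>t - x\<bar> < \<delta>" "t \<noteq> x"
    have "\<forall>\<^sub>F y in at t within {a..b}. ereal c \<le> ereal (slope u t y)"
      by (rule eventually_at_within_Icc[of "\<delta> - \<bar>t - x\<bar>"]) (use t c in auto)
    moreover have "((\<lambda>y. ereal (slope u t y)) \<longlongrightarrow> ext_derivative u a b t) (at t within {a..b})"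
      using has_ext_derivative_upper_slope[OF assms(2,3) t(1)] D[OF t(1)]
      by (simp add: has_ext_derivative_iff)
    ultimately have "ereal c \<le> ext_derivative u a b t"
      using at_within_Icc_nontrivial[OF assms(1) t(1)] tendsto_lowerbound by blast
    then show "l < ext_derivative u a b t" using c(1) by simp
  qed
qed

lemma has_ext_derivative_uminus:
  "has_ext_derivative u d a b x \<Longrightarrow> has_ext_derivative (\<lambda>x. - u x) (- d) a b x"
  unfolding has_ext_derivative_iff slope_uminus using tendsto_uminus_ereal by fastforce

lemma ext_derivative_uminus:
  assumes "a < b" "slope_rigid u a b" "continuous_on {a..b} u" "x \<in> {a..b}"
  shows "ext_derivative (\<lambda>x. - u x) a b x = - ext_derivative u a b x"
  using ext_derivative_eq[OF assms(1,4)] has_ext_derivative_upper_slope[OF assms(2-4)]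
    has_ext_derivative_uminus by metis

text \<open>Rigidity is invariant under \<open>u \<mapsto> - u\<close>, so upper semicontinuity is
  lower semicontinuity for \<open>- u\<close>.\<close>

lemma continuous_on_ext_derivative:
  assumes "a < b" "slope_rigid u a b" "continuous_on {a..b} u"
  shows "continuous_on {a..b} (ext_derivative u a b)"
  unfolding continuous_on_def
proof (intro ballI order_tendstoI)
  fix x l assume "x \<in> {a..b}" "l < ext_derivative u a b x"
  then show "\<forall>\<^sub>F t in at x within {a..b}. l < ext_derivative u a b t"
    using ext_derivative_lsc assms by blast
next
  fix x l assume x: "x \<in> {a..b}" "ext_derivative u a b x < l"
  have "\<forall>\<^sub>F t in at x within {a..b}. - l < ext_derivative (\<lambda>x. - u x) a b t"
  proof (rule ext_derivative_lsc[OF assms(1) slope_rigid_uminus[OF assms(2)] _ x(1)])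
    show "continuous_on {a..b} (\<lambda>x. - u x)"
      by (intro continuous_intros assms)
    show "- l < ext_derivative (\<lambda>x. - u x) a b x"
      unfolding ext_derivative_uminus[OF assms x(1)] using x(2) by simp
  qed
  moreover have "\<forall>\<^sub>F t in at x within {a..b}. t \<in> {a..b}"
    by (simp add: eventually_at_filter)
  ultimately show "\<forall>\<^sub>F t in at x within {a..b}. ext_derivative u a b t < l"
    by eventually_elim (simp add: ext_derivative_uminus[OF assms])
qed

lemma differentiable_within_iff_has_ext_derivative:
  "u differentiable (at x within {a..b}) \<longleftrightarrow> (\<exists>d. has_ext_derivative u (ereal d) a b x)"
  unfolding has_ext_derivative_def lim_ereal real_differentiable_def has_field_derivative_iff ..

text \<open>An extended derivative exists everywhere, so differentiability only means that it is
  finite: the differentiability set is the preimage of the open set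
  \<open>{-\<infinity><..<\<infinity>}\<close> under a continuous map.\<close>

theorem tonelli_partial_regularity_of_slope_rigid:
  assumes "a < b" "slope_rigid u a b" "continuous_on {a..b} u"
  shows "tonelli_partial_regularity u a b"
proof -
  have has: "has_ext_derivative u (ext_derivative u a b x) a b x" if "x \<in> {a..b}" for x
    using has_ext_derivative_upper_slope[OF assms(2,3) that] ext_derivative_eq[OF assms(1) that] by simp
  have eq: "has_ext_derivative u d a b x \<longleftrightarrow> ext_derivative u a b x = d" if "x \<in> {a..b}" for x d
    using has[OF that] ext_derivative_eq[OF assms(1) that, of u d] by blast
  have diff: "u differentiable (at x within {a..b}) \<longleftrightarrow> ext_derivative u a b x \<in> {-\<infinity><..<\<infinity>}"
    if "x \<in> {a..b}" for x
    unfolding differentiable_within_iff_has_ext_derivative eq[OF that]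
    by (cases "ext_derivative u a b x") auto
  have "differentiability_set u a b = {a..b} \<inter> ext_derivative u a b -` {-\<infinity><..<\<infinity>}"
    unfolding differentiability_set_def using diff by auto
  moreover have "openin (top_of_set {a..b}) ({a..b} \<inter> ext_derivative u a b -` {-\<infinity><..<\<infinity>})"
    by (rule continuous_openin_preimage_gen[OF continuous_on_ext_derivative[OF assms] open_greaterThanLessThan])
  moreover have "{a..b} - differentiability_set u a b =
       {x \<in> {a..b}. has_ext_derivative u (-\<infinity>) a b x \<or> has_ext_derivative u \<infinity> a b x}"
    unfolding differentiability_set_def using eq diff by (auto simp: less_le)
  ultimately show ?thesis
    unfolding tonelli_partial_regularity_def using continuous_on_ext_derivative[OF assms] by simp
qed

section \<open>From affine approximation to rigidity\<close>

lemma slope_diff_le: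
  assumes "\<And>x. x1 \<le> x \<Longrightarrow> x \<le> x2 \<Longrightarrow>
      \<bar>u x - (u x1 + slope u x1 x2 * (x - x1))\<bar> \<le> C * (x2 - x1) powr (1 + \<gamma>)"
    and y: "x1 \<le> y1" "y1 < y2" "y2 \<le> x2" "x2 - x1 \<le> 2 * (y2 - y1)" and "C \<ge> 0"
  shows "\<bar>slope u y1 y2 - slope u x1 x2\<bar> \<le> 4 * C * (x2 - x1) powr \<gamma>"
proof -
  define h where "h = x2 - x1"
  have h: "h > 0" using y by (simp add: h_def)
  \<comment> \<open>Each of \<open>y1\<close>, \<open>y2\<close> contributes one deviation from the
    chord; dividing the two by a length of at least \<open>h / 2\<close> produces the factor
    \<open>4\<close>.\<close>
  have "\<bar>slope u y1 y2 - slope u x1 x2\<bar> * (h / 2) \<le> \<bar>slope u y1 y2 - slope u x1 x2\<bar> * (y2 - y1)"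
    using y by (intro mult_left_mono) (auto simp: h_def)
  also have "\<dots> = \<bar>(u y2 - u y1) - slope u x1 x2 * (y2 - y1)\<bar>"
    using y slope_eqD[of y1 y2 u] by (simp add: abs_mult flip: left_diff_distrib)
  also have "\<dots> \<le> \<bar>u y2 - (u x1 + slope u x1 x2 * (y2 - x1))\<bar> + \<bar>u y1 - (u x1 + slope u x1 x2 * (y1 - x1))\<bar>"
    by (simp add: algebra_simps)
  also have "\<dots> \<le> 2 * (C * h powr (1 + \<gamma>))"
    using assms(1)[of y1] assms(1)[of y2] y by (simp add: h_def)
  also have "\<dots> = (4 * C * h powr \<gamma>) * (h / 2)"
    using h by (simp add: powr_add)
  finally show ?thesis using h unfolding h_def[symmetric] by simp
qed

text \<open>
  A subinterval is reached from the ambient interval by successive halvings; each halving changes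
  the slope by \<open>O(h powr \<gamma>)\<close>, and these errors form a geometric series.
\<close>

lemma slope_rigid_of_affine_approx:
  assumes E: "\<And>M. \<exists>C \<gamma> \<epsilon>. C \<ge> 0 \<and> \<gamma> > 0 \<and> \<epsilon> > 0 \<and>
      (\<forall>x1 x2 x. a \<le> x1 \<and> x1 \<le> x \<and> x \<le> x2 \<and> x1 < x2 \<and> x2 \<le> b \<and> x2 - x1 \<le> \<epsilon> \<and> \<bar>slope u x1 x2\<bar> \<le> M \<longrightarrow>
         \<bar>u x - (u x1 + slope u x1 x2 * (x - x1))\<bar> \<le> C * (x2 - x1) powr (1 + \<gamma>))"
  shows "slope_rigid u a b"
  unfolding slope_rigid_def
proof (intro allI impI)
  fix M \<eta> :: real assume \<eta>: "\<eta> > 0"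
  \<comment> \<open>The slope may drift during the halvings; the slack \<open>1\<close> in
    \<open>M + 1\<close> leaves room for the total drift.\<close>
  obtain C \<gamma> \<epsilon> where C: "C \<ge> 0" "\<gamma> > 0" "\<epsilon> > 0" and
    "\<forall>x1 x2 x. a \<le> x1 \<and> x1 \<le> x \<and> x \<le> x2 \<and> x1 < x2 \<and> x2 \<le> b \<and> x2 - x1 \<le> \<epsilon> \<and> \<bar>slope u x1 x2\<bar> \<le> M + 1 \<longrightarrow>
         \<bar>u x - (u x1 + slope u x1 x2 * (x - x1))\<bar> \<le> C * (x2 - x1) powr (1 + \<gamma>)"
    using E[of "M + 1"] by blast
  then have approx: "\<bar>u x - (u x1 + slope u x1 x2 * (x - x1))\<bar> \<le> C * (x2 - x1) powr (1 + \<gamma>)"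
    if "a \<le> x1" "x1 \<le> x" "x \<le> x2" "x1 < x2" "x2 \<le> b" "x2 - x1 \<le> \<epsilon>" "\<bar>slope u x1 x2\<bar> \<le> M + 1" for x1 x2 x
    using that by blast
  have step: "\<bar>slope u y1 y2 - slope u x1 x2\<bar> \<le> 4 * C * (x2 - x1) powr \<gamma>"
    if "a \<le> x1" "x1 \<le> y1" "y1 < y2" "y2 \<le> x2" "x2 \<le> b" "x2 - x1 \<le> \<epsilon>" "\<bar>slope u x1 x2\<bar> \<le> M + 1"
      "x2 - x1 \<le> 2 * (y2 - y1)" for x1 y1 y2 x2
    by (rule slope_diff_le[OF approx]) (use that C in auto)
  define q :: real where "q = 2 powr (- \<gamma>)"
  have q: "0 < q" "q < 1" using C by (auto simp: q_def powr_less_one)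
  \<comment> \<open>The sum of the geometric series with first term \<open>4 * C\<close> and ratio
    \<open>q\<close>, used through its fixed point equation
    \<open>4 * C + K * q = K\<close>.\<close>
  define K where "K = 4 * C / (1 - q)"
  have K: "4 * C + K * q = K" "4 * C \<le> K" "K \<ge> 0"
    using q C by (auto simp: K_def field_simps)
  \<comment> \<open>The quantity
    \<open>\<bar>slope u x1 x2\<bar> + K * (x2 - x1) powr \<gamma>\<close> does not increase under
    halving: the slope gains at most \<open>4 * C * h powr \<gamma>\<close>, which is exactly what
    the second term loses. So the slope bound needed for \<open>step\<close> survives every
    halving.\<close>
  have iter: "\<bar>slope u y1 y2 - slope u x1 x2\<bar> \<le> K * (x2 - x1) powr \<gamma>"
    if "a \<le> x1" "x1 \<le> y1" "y1 < y2" "y2 \<le> x2" "x2 \<le> b" "x2 - x1 \<le> \<epsilon>"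
      "\<bar>slope u x1 x2\<bar> + K * (x2 - x1) powr \<gamma> \<le> M + 1" "x2 - x1 \<le> 2 ^ n * (y2 - y1)" for x1 y1 y2 x2 n
    using that
  proof (induction n arbitrary: x1 x2)
    case 0
    then have "y1 = x1" "y2 = x2" by auto
    then show ?case using K by simp
  next
    case (Suc n)
    have pos: "0 \<le> K * (x2 - x1) powr \<gamma>" using K by simp
    have s: "\<bar>slope u x1 x2\<bar> \<le> M + 1" using Suc.prems(7) pos by linarith
    show ?case
    proof (cases "x2 - x1 \<le> 2 * (y2 - y1)")
      case True
      have "4 * C * (x2 - x1) powr \<gamma> \<le> K * (x2 - x1) powr \<gamma>"
        using K by (intro mult_right_mono) auto
      with step[OF Suc.prems(1-6) s True] show ?thesis by simp
    next
      case False
      define h where "h = x2 - x1"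
      \<comment> \<open>The half-length interval that ends at \<open>y2\<close>, moved to the right
        if it would start before \<open>x1\<close>.\<close>
      define z where "z = max x1 (y2 - h / 2)"
      have z: "x1 \<le> z" "z \<le> y1" "y2 \<le> z + h / 2" "z + h / 2 \<le> x2"
        using False Suc.prems by (auto simp: z_def h_def max_def field_simps)
      have h: "h > 0" using Suc.prems by (simp add: h_def)
      have hq: "(h / 2) powr \<gamma> = q * h powr \<gamma>"
        using h by (simp add: q_def powr_divide powr_minus field_simps)
      have d: "\<bar>slope u z (z + h / 2) - slope u x1 x2\<bar> \<le> 4 * C * h powr \<gamma>"
        unfolding h_def by (rule step) (use z h Suc.prems s in \<open>auto simp: h_def\<close>)
      have e: "4 * C * h powr \<gamma> + K * (q * h powr \<gamma>) = K * h powr \<gamma>"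
        using K(1) by (metis distrib_right mult.assoc)
      have "\<bar>slope u y1 y2 - slope u z (z + h / 2)\<bar> \<le> K * (z + h / 2 - z) powr \<gamma>"
      proof (rule Suc.IH)
        show "\<bar>slope u z (z + h / 2)\<bar> + K * (z + h / 2 - z) powr \<gamma> \<le> M + 1"
          using d e hq Suc.prems(7) unfolding h_def[symmetric] by simp
        show "z + h / 2 - z \<le> 2 ^ n * (y2 - y1)"
          using Suc.prems(8) unfolding h_def[symmetric] by simp
      qed (use z h Suc.prems in \<open>auto simp: h_def\<close>)
      then have "\<bar>slope u y1 y2 - slope u z (z + h / 2)\<bar> \<le> K * (q * h powr \<gamma>)"
        using hq by simp
      then show ?thesis using d e unfolding h_def[symmetric] by linarith
    qed
  qed
  \<comment> \<open>\<open>1\<close> is the slack available to \<open>iter\<close>,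
    \<open>\<eta>\<close> the accuracy wanted.\<close>
  define m where "m = min 1 \<eta>"
  have m: "0 < m" "m \<le> 1" "m \<le> \<eta>" using \<eta> by (auto simp: m_def)
  \<comment> \<open>The denominator is \<open>K + 1\<close> because \<open>K\<close> vanishes when
    \<open>C\<close> does.\<close>
  define \<epsilon>' where "\<epsilon>' = min \<epsilon> ((m / (K + 1)) powr (1 / \<gamma>))"
  have small: "K * h powr \<gamma> \<le> m" if "0 \<le> h" "h \<le> \<epsilon>'" for h
  proof -
    have "h powr \<gamma> \<le> ((m / (K + 1)) powr (1 / \<gamma>)) powr \<gamma>"
      using that C by (intro powr_mono2) (auto simp: \<epsilon>'_def)
    also have "\<dots> = m / (K + 1)" using C m K by (simp add: powr_powr)
    finally have "(K + 1) * h powr \<gamma> \<le> m" using K by (simp add: field_simps)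
    moreover have "K * h powr \<gamma> \<le> (K + 1) * h powr \<gamma>" by (intro mult_right_mono) auto
    ultimately show ?thesis by linarith
  qed
  show "\<exists>\<epsilon>>0. \<forall>x1 y1 y2 x2. a \<le> x1 \<and> x1 \<le> y1 \<and> y1 < y2 \<and> y2 \<le> x2 \<and> x2 \<le> b \<and>
      x2 - x1 \<le> \<epsilon> \<and> \<bar>slope u x1 x2\<bar> \<le> M \<longrightarrow> \<bar>slope u y1 y2 - slope u x1 x2\<bar> \<le> \<eta>"
  proof (intro exI[of _ \<epsilon>'] conjI allI impI)
    show "\<epsilon>' > 0" using C m K by (simp add: \<epsilon>'_def)
    fix x1 y1 y2 x2
    assume A: "a \<le> x1 \<and> x1 \<le> y1 \<and> y1 < y2 \<and> y2 \<le> x2 \<and> x2 \<le> b \<and>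
      x2 - x1 \<le> \<epsilon>' \<and> \<bar>slope u x1 x2\<bar> \<le> M"
    obtain n where "(x2 - x1) / (y2 - y1) < 2 ^ n" using real_arch_pow[of 2] by auto
    then have n: "x2 - x1 \<le> 2 ^ n * (y2 - y1)" using A by (simp add: field_simps)
    have sm: "K * (x2 - x1) powr \<gamma> \<le> m" by (rule small) (use A in auto)
    have "\<bar>slope u y1 y2 - slope u x1 x2\<bar> \<le> K * (x2 - x1) powr \<gamma>"
      by (rule iter[OF _ _ _ _ _ _ _ n]) (use A sm m in \<open>auto simp: \<epsilon>'_def\<close>)
    then show "\<bar>slope u y1 y2 - slope u x1 x2\<bar> \<le> \<eta>" using sm m by linarith
  qed
qed

section \<open>Primitives of integrable functions\<close>

text \<open>The working form of \<open>W11\<close>: for \<open>a < b\<close> it is equivalent to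
  membership with weak derivative \<open>w\<close> (\<open>W11_iff_is_primitive\<close>). Every
  estimate can then be carried out with integrals alone.\<close>

definition is_primitive :: "(real \<Rightarrow> real) \<Rightarrow> (real \<Rightarrow> real) \<Rightarrow> real \<Rightarrow> real \<Rightarrow> bool" where
  "is_primitive u w a b \<longleftrightarrow>
     w absolutely_integrable_on {a..b} \<and> (\<forall>x\<in>{a..b}. u x = u a + integral {a..x} w)"

lemma is_primitive_integrable:
  assumes "is_primitive u w a b" "a \<le> x" "y \<le> b"
  shows "w absolutely_integrable_on {x..y}" "w integrable_on {x..y}"
proof -
  have "{x..y} \<subseteq> {a..b}" using assms(2,3) by auto
  with assms(1) show "w absolutely_integrable_on {x..y}"
    unfolding is_primitive_def by (blast intro: absolutely_integrable_on_subinterval)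
  then show "w integrable_on {x..y}" by (rule set_lebesgue_integral_eq_integral(1))
qed

lemma is_primitive_eq:
  "is_primitive u w a b \<Longrightarrow> x \<in> {a..b} \<Longrightarrow> u x = u a + integral {a..x} w"
  unfolding is_primitive_def by blast

lemma is_primitive_diff:
  assumes "is_primitive u w a b" "a \<le> x" "x \<le> y" "y \<le> b"
  shows "integral {x..y} w = u y - u x"
proof -
  have "integral {a..x} w + integral {x..y} w = integral {a..y} w"
    by (rule Henstock_Kurzweil_Integration.integral_combine) (use assms is_primitive_integrable(2)[OF assms(1), of a y] in auto)
  moreover have "u x = u a + integral {a..x} w" "u y = u a + integral {a..y} w"
    using is_primitive_eq[OF assms(1), of x] is_primitive_eq[OF assms(1), of y] assms(2-4) by simp_all
  ultimately show ?thesis by simp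
qed

lemma is_primitive_continuous:
  assumes "is_primitive u w a b"
  shows "continuous_on {a..b} u"
proof -
  have "continuous_on {a..b} (\<lambda>x. u a + integral {a..x} w)"
    by (intro continuous_intros indefinite_integral_continuous_1)
      (use is_primitive_integrable(2)[OF assms, of a b] in auto)
  then show ?thesis
    by (rule continuous_on_eq) (rule is_primitive_eq[OF assms, symmetric])
qed

lemma is_primitiveI_C1:
  assumes "\<And>x. x \<in> {a..b} \<Longrightarrow> (w has_real_derivative w' x) (at x within {a..b})"
    and "continuous_on {a..b} w'"
  shows "is_primitive w w' a b"
  unfolding is_primitive_def
proof (intro conjI ballI)
  show "w' absolutely_integrable_on {a..b}"
    using assms(2) by (rule absolutely_integrable_continuous_real)
  fix x assume x: "x \<in> {a..b}"
  have "(w' has_integral (w x - w a)) {a..x}"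
  proof (rule fundamental_theorem_of_calculus)
    fix t assume "t \<in> {a..x}"
    then have "(w has_real_derivative w' t) (at t within {a..x})"
      using assms(1)[of t] x by (auto intro: DERIV_subset)
    then show "(w has_vector_derivative w' t) (at t within {a..x})"
      by (simp add: has_real_derivative_iff_has_vector_derivative)
  qed (use x in auto)
  then show "w x = w a + integral {a..x} w'" by (simp add: integral_unique)
qed

lemma absolutely_integrable_mult_continuous:
  fixes w \<phi> :: "real \<Rightarrow> real"
  assumes "w absolutely_integrable_on {a..b}" "continuous_on {a..b} \<phi>"
  shows "(\<lambda>x. \<phi> x * w x) absolutely_integrable_on {a..b}"
proof (rule absolutely_integrable_bounded_measurable_product_real[OF _ _ _ assms(1)])
  show "\<phi> \<in> borel_measurable (lebesgue_on {a..b})"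
    by (rule continuous_imp_measurable_on_sets_lebesgue[OF assms(2)]) simp
  show "bounded (\<phi> ` {a..b})"
    by (intro compact_imp_bounded compact_continuous_image assms compact_Icc)
qed simp

text \<open>Cut the interval into \<open>n\<close> equal pieces shorter than \<open>\<delta>\<close>
  and telescope. In the application \<open>V\<close> is a multiple of an indefinite integral of a
  nonnegative function.\<close>

lemma abs_diff_le_of_local:
  fixes H V :: "real \<Rightarrow> real"
  assumes loc: "\<And>x y. a \<le> x \<Longrightarrow> x \<le> y \<Longrightarrow> y \<le> b \<Longrightarrow> y - x < \<delta> \<Longrightarrow> \<bar>H y - H x\<bar> \<le> V y - V x"
    and "\<delta> > 0" "a \<le> b"
  shows "\<bar>H b - H a\<bar> \<le> V b - V a"
proof -
  obtain n where n: "(b - a) / \<delta> < real n" using reals_Archimedean2 by blast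
  have "(b - a) / \<delta> \<ge> 0" using assms by simp
  with n have npos: "real n > 0" by linarith
  define h where "h = (b - a) / real n"
  have h: "0 \<le> h" "h < \<delta>" "real n * h = b - a"
    using assms npos n by (auto simp: h_def field_simps)
  have "i \<le> n \<Longrightarrow> \<bar>H (a + real i * h) - H a\<bar> \<le> V (a + real i * h) - V a" for i
  proof (induction i)
    case (Suc i)
    have "real (Suc i) * h \<le> real n * h"
      using Suc.prems h by (intro mult_right_mono) auto
    then have "\<bar>H (a + real (Suc i) * h) - H (a + real i * h)\<bar> \<le> V (a + real (Suc i) * h) - V (a + real i * h)"
      by (intro loc) (use h in \<open>auto simp: algebra_simps\<close>)
    with Suc show ?case by linarith
  qed simp
  from this[of n] h show ?thesis by simp
qed

text \<open>
  Over a short interval the boundary term \<open>u y * \<phi> y - u x * \<phi> x\<close> differs from the integral by the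
  oscillation of \<open>u\<close> and \<open>\<phi>\<close> times the integral of \<open>\<bar>w\<bar> + \<bar>\<phi>'\<bar>\<close>; summing over a fine partition,
  the error vanishes. This avoids the almost everywhere differentiability of \<open>u\<close>.
\<close>

lemma integration_by_parts_primitive:
  assumes prim: "is_primitive u w a b" and "a \<le> b"
    and prim': "is_primitive \<phi> \<phi>' a b"
  shows "integral {a..b} (\<lambda>x. \<phi> x * w x + u x * \<phi>' x) = u b * \<phi> b - u a * \<phi> a"
proof -
  have cont: "continuous_on {a..b} u" "continuous_on {a..b} \<phi>"
    using is_primitive_continuous prim prim' by auto
  have ai: "w absolutely_integrable_on {a..b}" "\<phi>' absolutely_integrable_on {a..b}"
    using prim prim' by (auto simp: is_primitive_def)
  define k where "k x = \<phi> x * w x + u x * \<phi>' x" for x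
  define v where "v x = \<bar>w x\<bar> + \<bar>\<phi>' x\<bar>" for x
  have "k absolutely_integrable_on {a..b}" "v absolutely_integrable_on {a..b}"
    unfolding k_def v_def
    by (intro set_integral_add absolutely_integrable_mult_continuous set_integrable_abs ai cont)+
  then have prk: "is_primitive (\<lambda>x. integral {a..x} k) k a b"
    and prv: "is_primitive (\<lambda>x. integral {a..x} v) v a b"
    by (auto simp: is_primitive_def)
  have bound: "\<bar>u b * \<phi> b - u a * \<phi> a - integral {a..b} k\<bar> \<le> e * integral {a..b} v" if e: "e > 0" for e
  proof -
    have uc: "uniformly_continuous_on {a..b} u" "uniformly_continuous_on {a..b} \<phi>"
      using cont by (auto intro: compact_uniformly_continuous)
    obtain d1 where d1: "d1 > 0" "\<And>x y. x \<in> {a..b} \<Longrightarrow> y \<in> {a..b} \<Longrightarrow> \<bar>y - x\<bar> < d1 \<Longrightarrow> \<bar>u y - u x\<bar> < e"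
      using uc(1)[unfolded uniformly_continuous_on_def, rule_format, OF e] by (auto simp: dist_real_def)
    obtain d2 where d2: "d2 > 0" "\<And>x y. x \<in> {a..b} \<Longrightarrow> y \<in> {a..b} \<Longrightarrow> \<bar>y - x\<bar> < d2 \<Longrightarrow> \<bar>\<phi> y - \<phi> x\<bar> < e"
      using uc(2)[unfolded uniformly_continuous_on_def, rule_format, OF e] by (auto simp: dist_real_def)
    have "\<bar>(u b * \<phi> b - integral {a..b} k) - (u a * \<phi> a - integral {a..a} k)\<bar>
        \<le> e * integral {a..b} v - e * integral {a..a} v"
    proof (rule abs_diff_le_of_local[where \<delta> = "min d1 d2"])
      fix x y assume xy: "a \<le> x" "x \<le> y" "y \<le> b" "y - x < min d1 d2"
      note int = is_primitive_integrable(2)[OF prim xy(1,3)] is_primitive_integrable(2)[OF prim' xy(1,3)]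
        is_primitive_integrable(2)[OF prk xy(1,3)] is_primitive_integrable(2)[OF prv xy(1,3)]
      \<comment> \<open>Taking \<open>\<phi>\<close> at the right end and \<open>u\<close> at the
        left end makes the discrete product rule exact.\<close>
      have "u y * \<phi> y - u x * \<phi> x = \<phi> y * (u y - u x) + u x * (\<phi> y - \<phi> x)"
        by (simp add: algebra_simps)
      also have "\<dots> = integral {x..y} (\<lambda>t. \<phi> y * w t + u x * \<phi>' t)"
        using int is_primitive_diff[OF prim xy(1-3)] is_primitive_diff[OF prim' xy(1-3)]
        by (simp add: integral_add integrable_on_mult_right)
      finally have eq: "u y * \<phi> y - u x * \<phi> x - integral {x..y} k =
          integral {x..y} (\<lambda>t. (\<phi> y * w t + u x * \<phi>' t) - k t)"
        using int by (simp add: integral_diff integrable_add integrable_on_mult_right)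
      have "norm (integral {x..y} (\<lambda>t. (\<phi> y * w t + u x * \<phi>' t) - k t)) \<le> integral {x..y} (\<lambda>t. e * v t)"
      proof (rule integral_norm_bound_integral)
        show "(\<lambda>t. (\<phi> y * w t + u x * \<phi>' t) - k t) integrable_on {x..y}" "(\<lambda>t. e * v t) integrable_on {x..y}"
          using int by (auto intro!: integrable_diff integrable_add integrable_on_mult_right)
        fix t assume t: "t \<in> {x..y}"
        have "(\<phi> y * w t + u x * \<phi>' t) - k t = (\<phi> y - \<phi> t) * w t + (u x - u t) * \<phi>' t"
          by (simp add: k_def algebra_simps)
        moreover have "\<bar>(\<phi> y - \<phi> t) * w t\<bar> \<le> e * \<bar>w t\<bar>" "\<bar>(u x - u t) * \<phi>' t\<bar> \<le> e * \<bar>\<phi>' t\<bar>"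
          unfolding abs_mult using d1(2)[of t x] d2(2)[of t y] t xy by (auto intro!: mult_right_mono)
        ultimately show "norm ((\<phi> y * w t + u x * \<phi>' t) - k t) \<le> e * v t"
          unfolding v_def real_norm_def distrib_left by linarith
      qed
      then have "\<bar>u y * \<phi> y - u x * \<phi> x - integral {x..y} k\<bar> \<le> e * integral {x..y} v"
        unfolding eq by simp
      then show "\<bar>(u y * \<phi> y - integral {a..y} k) - (u x * \<phi> x - integral {a..x} k)\<bar>
          \<le> e * integral {a..y} v - e * integral {a..x} v"
        using is_primitive_diff[OF prk xy(1-3)] is_primitive_diff[OF prv xy(1-3)]
        by (simp add: algebra_simps)
    qed (use d1 d2 assms in auto)
    then show ?thesis by (simp add: algebra_simps)
  qed
  have "\<bar>u b * \<phi> b - u a * \<phi> a - integral {a..b} k\<bar> \<le> 0"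
  proof (rule field_le_epsilon)
    fix e :: real assume e: "e > 0"
    define c where "c = \<bar>integral {a..b} v\<bar> + 1"
    have "\<bar>u b * \<phi> b - u a * \<phi> a - integral {a..b} k\<bar> \<le> e / c * integral {a..b} v"
      by (rule bound) (use e in \<open>simp add: c_def\<close>)
    also have "\<dots> \<le> e / c * c"
      by (rule mult_left_mono) (use e in \<open>auto simp: c_def\<close>)
    finally show "\<bar>u b * \<phi> b - u a * \<phi> a - integral {a..b} k\<bar> \<le> 0 + e"
      by (simp add: c_def split: if_splits)
  qed
  then show ?thesis unfolding k_def by simp
qed

section \<open>Primitives are weakly differentiable and absolutely continuous\<close>

lemma test_functionD:
  assumes "\<phi> \<in> test_functions a b"
  shows "(\<phi> has_real_derivative deriv \<phi> x) (at x)" "continuous_on UNIV (deriv \<phi>)"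
    "x \<notin> {a<..<b} \<Longrightarrow> \<phi> x = 0"
proof -
  from assms obtain D where D: "\<And>x. (\<phi> has_vector_derivative D x) (at x)" "continuous_on UNIV D"
    unfolding test_functions_def C1_differentiable_on_def by auto
  then have "(\<phi> has_real_derivative D x) (at x)" for x
    by (simp add: has_real_derivative_iff_has_vector_derivative)
  then have "deriv \<phi> = D" using DERIV_imp_deriv by blast
  then show "(\<phi> has_real_derivative deriv \<phi> x) (at x)" "continuous_on UNIV (deriv \<phi>)"
    using \<open>(\<phi> has_real_derivative D x) (at x)\<close> D by auto
  show "x \<notin> {a<..<b} \<Longrightarrow> \<phi> x = 0"
    using assms closure_subset[of "{x. \<phi> x \<noteq> 0}"] unfolding test_functions_def by blast
qed

lemma is_primitive_test_function:
  assumes "\<phi> \<in> test_functions a b"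
  shows "is_primitive \<phi> (deriv \<phi>) a b"
  by (rule is_primitiveI_C1)
    (use test_functionD[OF assms] in \<open>auto intro: DERIV_subset continuous_on_subset\<close>)

text \<open>Integration by parts; the boundary terms drop out because a test function vanishes at
  \<open>a\<close> and \<open>b\<close>.\<close>

lemma has_weak_derivative_of_primitive:
  assumes prim: "is_primitive u w a b" and "a \<le> b"
  shows "has_weak_derivative u w a b"
  unfolding has_weak_derivative_def
proof (intro conjI ballI)
  have cu: "continuous_on {a..b} u" by (rule is_primitive_continuous[OF prim])
  have iw: "w absolutely_integrable_on {a..b}" using prim by (simp add: is_primitive_def)
  show "set_integrable lebesgue {a..b} w" by (rule iw)
  show "set_integrable lebesgue {a..b} u" by (rule absolutely_integrable_continuous_real[OF cu])
  fix \<phi> assume \<phi>: "\<phi> \<in> test_functions a b"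
  note pr = is_primitive_test_function[OF \<phi>]
  have i1: "(\<lambda>x. u x * deriv \<phi> x) absolutely_integrable_on {a..b}"
    by (rule absolutely_integrable_mult_continuous[OF _ cu]) (use pr in \<open>simp add: is_primitive_def\<close>)
  have i2: "(\<lambda>x. \<phi> x * w x) absolutely_integrable_on {a..b}"
    by (rule absolutely_integrable_mult_continuous[OF iw is_primitive_continuous[OF pr]])
  have "integral {a..b} (\<lambda>x. \<phi> x * w x) + integral {a..b} (\<lambda>x. u x * deriv \<phi> x) = 0"
    using integration_by_parts_primitive[OF prim assms(2) pr] test_functionD(3)[OF \<phi>]
      i1[THEN set_lebesgue_integral_eq_integral(1)] i2[THEN set_lebesgue_integral_eq_integral(1)]
    by (simp add: integral_add)
  then show "(LINT x:{a..b}|lebesgue. u x * deriv \<phi> x) = - (LINT x:{a..b}|lebesgue. w x * \<phi> x)"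
    using i1 i2 by (simp add: set_lebesgue_integral_eq_integral(2) mult.commute)
qed

text \<open>Truncation: \<open>\<bar>w\<bar>\<close> is the sum of a part bounded by
  \<open>n\<close> and a remainder \<open>r\<close> of integral below \<open>\<epsilon> / 2\<close>.
  The bounded part contributes at most \<open>n\<close> times the total length, whence
  \<open>\<delta> = \<epsilon> / (2 * (n + 1))\<close>.\<close>

lemma abs_continuous_of_primitive:
  assumes prim: "is_primitive u w a b"
  shows "abs_continuous_on_interval u a b"
  unfolding abs_continuous_on_interval_def
proof (intro allI impI)
  fix \<epsilon> :: real assume \<epsilon>: "\<epsilon> > 0"
  have iw: "w absolutely_integrable_on {a..b}" using prim by (simp add: is_primitive_def)
  define m where "m n x = min \<bar>w x\<bar> (real n)" for n x
  have im: "m n absolutely_integrable_on {a..b}" for n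
    unfolding m_def by (rule absolutely_integrable_min_1) (use iw in \<open>auto intro: set_integrable_abs\<close>)
  have iabs: "(\<lambda>x. \<bar>w x\<bar>) absolutely_integrable_on {a..b}"
    using iw by (rule set_integrable_abs)
  have "(\<lambda>n. integral {a..b} (m n)) \<longlonglongrightarrow> integral {a..b} (\<lambda>x. \<bar>w x\<bar>)"
  proof (rule dominated_convergence(2)[where h = "\<lambda>x. \<bar>w x\<bar>"])
    show "m n integrable_on {a..b}" for n using im set_lebesgue_integral_eq_integral(1) by blast
    show "(\<lambda>x. \<bar>w x\<bar>) integrable_on {a..b}" using iabs set_lebesgue_integral_eq_integral(1) by blast
    show "(\<lambda>n. m n x) \<longlonglongrightarrow> \<bar>w x\<bar>" for x
    proof (rule tendsto_eventually)
      obtain N where "\<bar>w x\<bar> \<le> real N" using real_arch_simple by blast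
      then show "\<forall>\<^sub>F n in sequentially. m n x = \<bar>w x\<bar>"
        by (intro eventually_sequentiallyI[of N]) (auto simp: m_def)
    qed
  qed (auto simp: m_def)
  then have "\<forall>\<^sub>F n in sequentially. integral {a..b} (m n) > integral {a..b} (\<lambda>x. \<bar>w x\<bar>) - \<epsilon> / 2"
    using \<epsilon> by (auto intro: order_tendstoD)
  then obtain n where n: "integral {a..b} (m n) > integral {a..b} (\<lambda>x. \<bar>w x\<bar>) - \<epsilon> / 2"
    by (meson eventually_happens trivial_limit_sequentially)
  define r where "r x = \<bar>w x\<bar> - m n x" for x
  have ir: "r absolutely_integrable_on {a..b}"
    unfolding r_def by (intro set_integral_diff iabs im)
  have r0: "r x \<ge> 0" for x by (simp add: r_def m_def)
  have int_r: "integral {a..b} r < \<epsilon> / 2"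
    using n iabs im set_lebesgue_integral_eq_integral(1) unfolding r_def by (subst integral_diff) auto
  show "\<exists>\<delta>>0. \<forall>D S. D division_of S \<and> S \<subseteq> {a..b} \<and> (\<Sum>K\<in>D. Sup K - Inf K) < \<delta> \<longrightarrow>
      (\<Sum>K\<in>D. \<bar>u (Sup K) - u (Inf K)\<bar>) < \<epsilon>"
  proof (intro exI[of _ "\<epsilon> / (2 * (real n + 1))"] conjI allI impI)
    show "\<epsilon> / (2 * (real n + 1)) > 0" using \<epsilon> by simp
    fix D :: "real set set" and S
    assume A: "D division_of S \<and> S \<subseteq> {a..b} \<and> (\<Sum>K\<in>D. Sup K - Inf K) < \<epsilon> / (2 * (real n + 1))"
    then have D: "D division_of S" by blast
    have K: "\<bar>u (Sup K) - u (Inf K)\<bar> \<le> integral K r + real n * (Sup K - Inf K)" if "K \<in> D" for K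
    proof -
      have "K \<noteq> {}" "\<exists>c d. K = {c..d}"
        using division_ofD(3,4)[OF D that] by auto
      then obtain c d where cd: "K = {c..d}" "c \<le> d" by auto
      have "{c..d} \<subseteq> {a..b}" using division_ofD(2)[OF D that] A cd(1) by (meson order_trans)
      then have sub: "a \<le> c" "d \<le> b" using cd(2) by auto
      have irs: "r integrable_on {c..d}"
        by (rule integrable_on_subinterval[of r "{a..b}"])
          (use sub ir set_lebesgue_integral_eq_integral(1) in auto)
      have "\<bar>u d - u c\<bar> = norm (integral {c..d} w)"
        using is_primitive_diff[OF prim sub(1) cd(2) sub(2)] by simp
      also have "\<dots> \<le> integral {c..d} (\<lambda>x. r x + real n)"
      proof (rule integral_norm_bound_integral)
        show "(\<lambda>x. r x + real n) integrable_on {c..d}" by (intro integrable_add irs integrable_const_ivl)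
        show "w integrable_on {c..d}" by (rule is_primitive_integrable(2)[OF prim sub])
      qed (auto simp: r_def m_def)
      also have "\<dots> = integral {c..d} r + real n * (d - c)"
        using irs cd by (subst integral_add) auto
      finally show ?thesis using cd by simp
    qed
    have irS: "r integrable_on S"
      by (rule integrable_on_subdivision[OF D set_lebesgue_integral_eq_integral(1)[OF ir]]) (use A in blast)
    have "integral S r = (\<Sum>K\<in>D. integral K r)"
      by (rule integral_combine_division_topdown[OF irS D])
    moreover have "integral S r \<le> integral {a..b} r"
      by (rule integral_subset_le[OF _ irS set_lebesgue_integral_eq_integral(1)[OF ir]]) (use A r0 in auto)
    moreover have "(\<Sum>K\<in>D. \<bar>u (Sup K) - u (Inf K)\<bar>) \<le> (\<Sum>K\<in>D. integral K r + real n * (Sup K - Inf K))"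
      by (rule sum_mono) (rule K)
    moreover have "\<dots> = (\<Sum>K\<in>D. integral K r) + real n * (\<Sum>K\<in>D. Sup K - Inf K)"
      by (simp add: sum.distrib sum_distrib_left)
    moreover have "real n * (\<Sum>K\<in>D. Sup K - Inf K) \<le> real n * (\<epsilon> / (2 * (real n + 1)))"
      using A by (intro mult_left_mono) auto
    moreover have "real n * (\<epsilon> / (2 * (real n + 1))) \<le> \<epsilon> / 2"
      using \<epsilon> by (simp add: field_simps)
    ultimately show "(\<Sum>K\<in>D. \<bar>u (Sup K) - u (Inf K)\<bar>) < \<epsilon>"
      using int_r by linarith
  qed
qed

lemma abs_continuous_imp_continuous_on:
  assumes "abs_continuous_on_interval u a b"
  shows "continuous_on {a..b} u"
  unfolding continuous_on_iff
proof (intro ballI allI impI)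
  fix x \<epsilon> :: real assume x: "x \<in> {a..b}" and "\<epsilon> > 0"
  with assms obtain \<delta> where \<delta>: "\<delta> > 0" "\<And>D S. D division_of S \<Longrightarrow> S \<subseteq> {a..b} \<Longrightarrow>
      (\<Sum>K\<in>D. Sup K - Inf K) < \<delta> \<Longrightarrow> (\<Sum>K\<in>D. \<bar>u (Sup K) - u (Inf K)\<bar>) < \<epsilon>"
    unfolding abs_continuous_on_interval_def by meson
  have *: "\<bar>u d - u c\<bar> < \<epsilon>" if "a \<le> c" "c \<le> d" "d \<le> b" "d - c < \<delta>" for c d
  proof -
    have "{{c..d}} division_of {c..d}"
      using that division_of_self[of c d] by simp
    from \<delta>(2)[OF this] that show ?thesis by simp
  qed
  show "\<exists>d>0. \<forall>x'\<in>{a..b}. dist x' x < d \<longrightarrow> dist (u x') (u x) < \<epsilon>"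
  proof (intro exI[of _ \<delta>] conjI ballI impI)
    fix y assume "y \<in> {a..b}" "dist y x < \<delta>"
    then show "dist (u y) (u x) < \<epsilon>"
      using *[of x y] *[of y x] x by (cases "x \<le> y") (auto simp: dist_real_def)
  qed (rule \<delta>)
qed

section \<open>The du Bois-Reymond lemma by means of hat functions\<close>

definition tent :: "real \<Rightarrow> real \<Rightarrow> real" where
  "tent r t = max 0 (t + r) - 2 * max 0 t + max 0 (t - r)"

text \<open>For \<open>r > 0\<close>, \<open>tent r t\<close> is the hat
  \<open>max 0 (r - \<bar>t\<bar>)\<close>, written as a second difference of
  \<open>max 0 t\<close>. The same second difference of \<open>(max 0 t)\<^sup>2 / 2\<close> is its
  antiderivative, without any case distinction.\<close>

definition tent_integral :: "real \<Rightarrow> real \<Rightarrow> real" where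
  "tent_integral r t = ((max 0 (t + r))\<^sup>2 - 2 * (max 0 t)\<^sup>2 + (max 0 (t - r))\<^sup>2) / 2"

lemma tent_simps:
  assumes "r > 0"
  shows "\<bar>t\<bar> \<ge> r \<Longrightarrow> tent r t = 0" "tent r t \<ge> 0" "tent r 0 = r"
  using assms unfolding tent_def max_def by (smt (verit))+

lemma tent_integral_simps:
  assumes "r > 0"
  shows "t \<le> - r \<Longrightarrow> tent_integral r t = 0" "t \<ge> r \<Longrightarrow> tent_integral r t = r\<^sup>2"
proof -
  show "t \<le> - r \<Longrightarrow> tent_integral r t = 0"
    using assms by (simp add: tent_integral_def max_absorb1)
  show "t \<ge> r \<Longrightarrow> tent_integral r t = r\<^sup>2"
    using assms by (simp add: tent_integral_def max_absorb2 power2_eq_square algebra_simps)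
qed

lemma DERIV_max_0_square: "((\<lambda>t. (max 0 t)\<^sup>2) has_real_derivative 2 * max 0 x) (at x)"
proof -
  consider "x > 0" | "x < 0" | "x = 0" by linarith
  then show ?thesis
  proof cases
    case 1
    have "((\<lambda>t. t\<^sup>2) has_real_derivative 2 * max 0 x) (at x)"
      using 1 by (auto intro!: derivative_eq_intros)
    then show ?thesis
      by (rule has_field_derivative_transform_within_open[of _ _ _ "{0<..}"]) (use 1 in auto)
  next
    case 2
    have "((\<lambda>t. 0) has_real_derivative 2 * max 0 x) (at x)"
      using 2 by (auto intro!: derivative_eq_intros)
    then show ?thesis
      by (rule has_field_derivative_transform_within_open[of _ _ _ "{..<0}"]) (use 2 in auto)
  next
    case 3
    have "((\<lambda>y. (max 0 y)\<^sup>2 / y) \<longlongrightarrow> 0) (at (0::real))"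
    proof (rule tendsto_sandwich)
      show "\<forall>\<^sub>F y in at (0::real). 0 - \<bar>y\<bar> \<le> (max 0 y)\<^sup>2 / y"
        by (rule always_eventually) (auto simp: max_def power2_eq_square)
      show "\<forall>\<^sub>F y in at (0::real). (max 0 y)\<^sup>2 / y \<le> \<bar>y\<bar>"
        by (rule always_eventually) (auto simp: max_def power2_eq_square)
      show "((\<lambda>y. 0 - \<bar>y\<bar>) \<longlongrightarrow> 0) (at (0::real))" "((\<lambda>y. \<bar>y\<bar>) \<longlongrightarrow> 0) (at (0::real))"
        by (auto intro!: tendsto_eq_intros)
    qed
    then show ?thesis using 3 by (simp add: has_field_derivative_iff)
  qed
qed

lemma DERIV_tent_integral: "(tent_integral r has_real_derivative tent r x) (at x)"
proof -
  have "((\<lambda>t. (max 0 (t + c))\<^sup>2) has_real_derivative 2 * max 0 (x + c)) (at x)" for c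
    using DERIV_shift[of "\<lambda>t. (max 0 t)\<^sup>2" "2 * max 0 (x + c)" x c] DERIV_max_0_square[of "x + c"] by simp
  from DERIV_cdivide[OF DERIV_add[OF DERIV_diff[OF this[of r] DERIV_cmult[OF this[of 0], of 2]] this[of "- r"]], of 2]
  show ?thesis
    unfolding tent_integral_def[abs_def] tent_def by (simp add: diff_divide_distrib add_divide_distrib)
qed

text \<open>A single antiderivative keeps the value \<open>r\<^sup>2\<close> to the right of its
  hat. In the difference of two translates these constants cancel, which makes the support
  compact.\<close>

lemma tent_diff_test_function:
  assumes "r > 0" "a < p - r" "p + r < b" "a < q - r" "q + r < b"
  shows "(\<lambda>x. tent_integral r (x - p) - tent_integral r (x - q)) \<in> test_functions a b"
    "deriv (\<lambda>x. tent_integral r (x - p) - tent_integral r (x - q)) = (\<lambda>x. tent r (x - p) - tent r (x - q))"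
proof -
  let ?\<phi> = "\<lambda>x. tent_integral r (x - p) - tent_integral r (x - q)"
  have D: "(?\<phi> has_real_derivative tent r (x - p) - tent r (x - q)) (at x)" for x
  proof -
    have "((\<lambda>x. tent_integral r (x - c)) has_real_derivative tent r (x - c)) (at x)" for c
      using DERIV_shift[of "tent_integral r" "tent r (x - c)" x "- c"] DERIV_tent_integral by simp
    then show ?thesis by (intro DERIV_diff)
  qed
  then show "deriv ?\<phi> = (\<lambda>x. tent r (x - p) - tent r (x - q))"
    using DERIV_imp_deriv by blast
  have supp: "{x. ?\<phi> x \<noteq> 0} \<subseteq> {min p q - r..max p q + r}"
  proof (rule subsetI, rule ccontr)
    fix x assume x: "x \<in> {x. ?\<phi> x \<noteq> 0}" "x \<notin> {min p q - r..max p q + r}"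
    then consider "x - p \<le> - r \<and> x - q \<le> - r" | "x - p \<ge> r \<and> x - q \<ge> r" by fastforce
    then have "?\<phi> x = 0" by cases (use assms(1) in \<open>auto simp: tent_integral_simps\<close>)
    then show False using x by simp
  qed
  then have cl: "closure {x. ?\<phi> x \<noteq> 0} \<subseteq> {min p q - r..max p q + r}"
    by (rule closure_minimal) simp
  have "compact (closure {x. ?\<phi> x \<noteq> 0})"
    unfolding compact_eq_bounded_closed
    using bounded_subset[OF compact_imp_bounded[OF compact_Icc] cl] by simp
  moreover have "closure {x. ?\<phi> x \<noteq> 0} \<subseteq> {a<..<b}"
    using cl assms by fastforce
  moreover have "?\<phi> C1_differentiable_on UNIV"
    unfolding C1_differentiable_on_def
    by (rule exI[of _ "\<lambda>x. tent r (x - p) - tent r (x - q)"])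
      (use D in \<open>auto simp: tent_def has_real_derivative_iff_has_vector_derivative intro!: continuous_intros\<close>)
  ultimately show "?\<phi> \<in> test_functions a b" unfolding test_functions_def by blast
qed

text \<open>
  If \<open>c p > m > c q\<close>, then testing \<open>c - m\<close> against the difference of two narrow tents
  at \<open>p\<close> and \<open>q\<close> gives a positive integral.
\<close>

lemma le_of_weakly_constant:
  assumes c: "continuous_on {a..b} c" and pq: "a < p" "p < b" "a < q" "q < b"
    and weak: "\<And>\<phi>. \<phi> \<in> test_functions a b \<Longrightarrow> integral {a..b} (\<lambda>x. c x * deriv \<phi> x) = 0"
  shows "c p \<le> c q"
proof (rule ccontr)
  assume neg: "\<not> c p \<le> c q"
  define m where "m = (c p + c q) / 2"
  have m: "c q < m" "m < c p" using neg by (auto simp: m_def)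
  have ic: "isCont c p" "isCont c q"
    using c pq by (auto intro: continuous_on_interior)
  have "\<forall>\<^sub>F x in nhds p. c x > m"
    using ic(1) m(2) unfolding isCont_def tendsto_at_iff_tendsto_nhds by (auto intro: order_tendstoD)
  then obtain d1 where d1: "d1 > 0" "\<And>x. \<bar>x - p\<bar> < d1 \<Longrightarrow> c x > m"
    unfolding eventually_nhds_metric dist_real_def by blast
  have "\<forall>\<^sub>F x in nhds q. c x < m"
    using ic(2) m(1) unfolding isCont_def tendsto_at_iff_tendsto_nhds by (auto intro: order_tendstoD)
  then obtain d2 where d2: "d2 > 0" "\<And>x. \<bar>x - q\<bar> < d2 \<Longrightarrow> c x < m"
    unfolding eventually_nhds_metric dist_real_def by blast
  define r where "r = min (min d1 d2) (min (min (p - a) (b - p)) (min (q - a) (b - q))) / 2"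
  have r: "r > 0" "r < d1" "r < d2" "a < p - r" "p + r < b" "a < q - r" "q + r < b"
    using d1 d2 pq unfolding r_def by (auto simp: min_def field_simps)
  define \<psi> where "\<psi> x = tent r (x - p) - tent r (x - q)" for x
  note test = tent_diff_test_function[OF r(1,4-7)]
  have cont: "continuous_on {a..b} (\<lambda>x. c x * \<psi> x)" "continuous_on {a..b} \<psi>"
    unfolding \<psi>_def tent_def by (intro continuous_intros c)+
  have "integral {a..b} (\<lambda>x. c x * \<psi> x) = 0"
    using weak[OF test(1)] unfolding test(2) \<psi>_def .
  moreover have "integral {a..b} \<psi> = 0"
  proof -
    have "is_primitive (\<lambda>x. tent_integral r (x - p) - tent_integral r (x - q)) \<psi> a b"
      using is_primitive_test_function[OF test(1)] unfolding test(2) \<psi>_def .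
    from is_primitive_diff[OF this, of a b] show ?thesis
      using pq test_functionD(3)[OF test(1)] by force
  qed
  ultimately have zero: "integral {a..b} (\<lambda>x. c x * \<psi> x - m * \<psi> x) = 0"
    using cont by (subst integral_diff) (auto intro!: integrable_continuous_real continuous_intros)
  have nonneg: "c x * \<psi> x - m * \<psi> x \<ge> 0" for x
  proof -
    consider "\<bar>x - p\<bar> < r" | "\<bar>x - q\<bar> < r" | "\<bar>x - p\<bar> \<ge> r" "\<bar>x - q\<bar> \<ge> r" by linarith
    then have "(c x - m) * \<psi> x \<ge> 0"
    proof cases
      case 1
      then have cx: "c x > m" using d1 r by auto
      then have "\<bar>x - q\<bar> \<ge> r" using d2(2)[of x] r by fastforce
      then show ?thesis using cx tent_simps[OF r(1)] by (simp add: \<psi>_def)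
    next
      case 2
      then have cx: "c x < m" using d2 r by auto
      then have "\<bar>x - p\<bar> \<ge> r" using d1(2)[of x] r by fastforce
      then show ?thesis using cx tent_simps[OF r(1)] by (simp add: \<psi>_def mult_nonpos_nonneg)
    next
      case 3
      then show ?thesis using tent_simps[OF r(1)] by (simp add: \<psi>_def)
    qed
    then show ?thesis by (simp add: algebra_simps)
  qed
  \<comment> \<open>A continuous nonnegative integrand with integral zero vanishes identically,
    whereas at \<open>p\<close> it equals \<open>(c p - m) * r > 0\<close>, as the hat at
    \<open>q\<close> does not reach \<open>p\<close>.\<close>
  have "\<forall>x\<in>{a..b}. c x * \<psi> x - m * \<psi> x = 0"
  proof (subst integral_eq_0_iff[symmetric])
    show "continuous_on {a..b} (\<lambda>x. c x * \<psi> x - m * \<psi> x)" by (intro continuous_intros cont)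
  qed (use zero nonneg pq in auto)
  then have "(c p - m) * \<psi> p = 0" using pq by (auto simp: algebra_simps)
  moreover have "\<bar>p - q\<bar> \<ge> r" using d1(2)[of q] r m by (auto simp: abs_minus_commute not_less[symmetric])
  ultimately show False using m r(1) tent_simps[OF r(1)] by (simp add: \<psi>_def)
qed

text \<open>The difference of \<open>u\<close> and the indefinite integral of \<open>w\<close> has
  weak derivative zero, so it is constant in the open interval, and up to the end points because
  \<open>u\<close> is the continuous representative.\<close>

lemma is_primitive_of_weak_derivative:
  assumes wd: "has_weak_derivative u w a b" and cu: "continuous_on {a..b} u" and ab: "a < b"
  shows "is_primitive u w a b"
proof -
  define U where "U x = integral {a..x} w" for x
  have iw: "w absolutely_integrable_on {a..b}" using wd unfolding has_weak_derivative_def by simp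
  then have pU: "is_primitive U w a b" by (auto simp: is_primitive_def U_def)
  have cU: "continuous_on {a..b} U" by (rule is_primitive_continuous[OF pU])
  define c where "c x = u x - U x" for x
  have cc: "continuous_on {a..b} c" unfolding c_def by (intro continuous_intros cu cU)
  have weak: "integral {a..b} (\<lambda>x. c x * deriv \<phi> x) = 0" if \<phi>: "\<phi> \<in> test_functions a b" for \<phi>
  proof -
    have "(LINT x:{a..b}|lebesgue. u x * deriv \<phi> x) = (LINT x:{a..b}|lebesgue. U x * deriv \<phi> x)"
      using wd has_weak_derivative_of_primitive[OF pU] ab \<phi> unfolding has_weak_derivative_def by auto
    moreover have cont: "continuous_on {a..b} (\<lambda>x. u x * deriv \<phi> x)" "continuous_on {a..b} (\<lambda>x. U x * deriv \<phi> x)"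
      by (intro continuous_intros cu cU continuous_on_subset[OF test_functionD(2)[OF \<phi>]] subset_UNIV)+
    ultimately have "integral {a..b} (\<lambda>x. u x * deriv \<phi> x) = integral {a..b} (\<lambda>x. U x * deriv \<phi> x)"
      by (simp add: set_lebesgue_integral_eq_integral(2) absolutely_integrable_continuous_real)
    then show ?thesis
      using cont unfolding c_def left_diff_distrib
      by (subst integral_diff) (auto intro!: integrable_continuous_real)
  qed
  define p where "p = (a + b) / 2"
  have p: "a < p" "p < b" using ab by (auto simp: p_def)
  have const: "c x = c p" if "x \<in> {a<..<b}" for x
    using le_of_weakly_constant[OF cc _ _ p weak, of x] le_of_weakly_constant[OF cc p _ _ weak, of x] that by force
  have "c x = c p" if "x \<in> {a..b}" for x
    by (rule continuous_constant_on_closure[of "{a<..<b}"]) (use cc const that ab in auto)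
  then have "u x = u a + U x" if "x \<in> {a..b}" for x
    using that ab unfolding c_def U_def by (metis add.commute add.right_neutral atLeastAtMost_iff
      diff_add_cancel diff_zero integral_singleton less_eq_real_def order_refl atLeastAtMost_singleton)
  then show ?thesis using iw unfolding is_primitive_def U_def by blast
qed

text \<open>The difference \<open>z\<close>, cut off outside \<open>{a..b}\<close>, has integral
  zero over every interval. By Lebesgue differentiation its averages over short intervals converge
  to \<open>z x\<close> off a null set, so \<open>z x = 0\<close> there.\<close>

lemma is_primitive_unique:
  assumes "is_primitive u w1 a b" "is_primitive u w2 a b"
  shows "negligible {x \<in> {a..b}. w1 x \<noteq> w2 x}"
proof -
  define z where "z x = (if x \<in> {a..b} then w1 x - w2 x else 0)" for x
  have int: "(z has_integral 0) (cbox c d)" for c d :: real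
  proof -
    define c' d' where "c' = max a c" and "d' = min b d"
    have sub: "a \<le> c'" "d' \<le> b" by (auto simp: c'_def d'_def)
    have i: "w1 integrable_on {c'..d'}" "w2 integrable_on {c'..d'}"
      using is_primitive_integrable(2)[OF _ sub] assms by auto
    have "integral {c'..d'} w1 = integral {c'..d'} w2"
      using is_primitive_diff[OF assms(1) sub(1) _ sub(2)] is_primitive_diff[OF assms(2) sub(1) _ sub(2)]
      by (cases "c' \<le> d'") auto
    then have "((\<lambda>x. w1 x - w2 x) has_integral 0) {c'..d'}"
      using has_integral_diff[OF integrable_integral[OF i(1)] integrable_integral[OF i(2)]] by simp
    moreover have "{c'..d'} = {a..b} \<inter> cbox c d" by (auto simp: c'_def d'_def)
    ultimately show ?thesis
      using has_integral_restrict_Int[of "{a..b}" "\<lambda>x. w1 x - w2 x" 0 "cbox c d"] unfolding z_def by metis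
  qed
  obtain N where N: "negligible N" "\<And>x e. x \<notin> N \<Longrightarrow> 0 < e \<Longrightarrow> \<exists>d>0. \<forall>h. 0 < h \<and> h < d \<longrightarrow>
      norm (integral (cbox x (x + h *\<^sub>R One)) z /\<^sub>R h ^ DIM(real) - z x) < e"
    by (rule integrable_ccontinuous_explicit[of z, OF has_integral_integrable[OF int]]) blast
  have "z x = 0" if xN: "x \<notin> N" for x
  proof (rule ccontr)
    assume "z x \<noteq> 0"
    then obtain d where d: "d > 0" "\<And>h. 0 < h \<Longrightarrow> h < d \<Longrightarrow>
        norm (integral (cbox x (x + h *\<^sub>R One)) z /\<^sub>R h ^ DIM(real) - z x) < \<bar>z x\<bar>"
      using N(2)[OF xN, of "\<bar>z x\<bar>"] by auto
    from d(2)[of "d / 2"] d(1) show False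
      unfolding integral_unique[OF int] by simp
  qed
  then have "{x \<in> {a..b}. w1 x \<noteq> w2 x} \<subseteq> N" by (force simp: z_def)
  with N(1) show ?thesis by (rule negligible_subset)
qed

lemma W11_iff_is_primitive:
  assumes "a < b"
  shows "u \<in> W11 a b \<longleftrightarrow> (\<exists>w. is_primitive u w a b)"
proof
  assume "u \<in> W11 a b"
  then show "\<exists>w. is_primitive u w a b"
    using assms is_primitive_of_weak_derivative abs_continuous_imp_continuous_on
    unfolding W11_def by blast
next
  assume "\<exists>w. is_primitive u w a b"
  then show "u \<in> W11 a b"
    using assms has_weak_derivative_of_primitive abs_continuous_of_primitive
    unfolding W11_def by fastforce
qed

lemma is_primitive_weak_derivative:
  assumes "a < b" "u \<in> W11 a b"
  shows "is_primitive u (weak_derivative u a b) a b"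
proof -
  have "has_weak_derivative u (weak_derivative u a b) a b"
    using assms(2) someI_ex[of "\<lambda>w. has_weak_derivative u w a b"] unfolding W11_def weak_derivative_def by blast
  then show ?thesis
    using assms abs_continuous_imp_continuous_on
    by (auto simp: W11_def intro: is_primitive_of_weak_derivative)
qed

section \<open>Uniformly convex Lagrangians\<close>

text \<open>The Lagrange remainder. The bound on \<open>\<xi>\<close> keeps it in a compact range,
  where \<open>L_vv\<close> is bounded.\<close>

lemma Taylor_second_order:
  fixes F F' F'' :: "real \<Rightarrow> real"
  assumes "\<And>v. (F has_real_derivative F' v) (at v)" "\<And>v. (F' has_real_derivative F'' v) (at v)"
  shows "\<exists>\<xi>. \<bar>\<xi>\<bar> \<le> max \<bar>s\<bar> \<bar>v\<bar> \<and> F v = F s + F' s * (v - s) + F'' \<xi> / 2 * (v - s)\<^sup>2"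
proof (cases "v = s")
  case True
  then show ?thesis by (intro exI[of _ s]) auto
next
  case False
  define D where "D m = (if m = 0 then F else if m = Suc 0 then F' else F'')" for m :: nat
  have "\<exists>\<xi>. (if v < s then v < \<xi> \<and> \<xi> < s else s < \<xi> \<and> \<xi> < v) \<and>
      F v = (\<Sum>m<2. D m s / fact m * (v - s) ^ m) + D 2 \<xi> / fact 2 * (v - s) ^ 2"
    by (rule Taylor[of 2 D F "min s v" "max s v"])
      (use assms False in \<open>auto simp: D_def less_2_cases_iff\<close>)
  then obtain \<xi> where "if v < s then v < \<xi> \<and> \<xi> < s else s < \<xi> \<and> \<xi> < v"
    "F v = F s + F' s * (v - s) + F'' \<xi> / 2 * (v - s)\<^sup>2"
    by (auto simp: D_def numeral_2_eq_2)
  then show ?thesis by (intro exI[of _ \<xi>]) (auto simp: max_def abs_if split: if_splits)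
qed

lemma abs_bounded_on_compact:
  fixes f :: "'a :: topological_space \<Rightarrow> real"
  assumes "compact S" "continuous_on S f"
  obtains B where "B \<ge> 0" "\<And>x. x \<in> S \<Longrightarrow> \<bar>f x\<bar> \<le> B"
proof -
  obtain B where B: "\<And>x. x \<in> S \<Longrightarrow> \<bar>f x\<bar> \<le> B"
    using compact_imp_bounded[OF compact_continuous_image[OF assms(2,1)]]
    unfolding bounded_iff by (metis imageI real_norm_def)
  show thesis
    by (rule that[of "max B 0"]) (use B in \<open>auto simp: le_max_iff_disj\<close>)
qed

locale uniformly_convex_lagrangian =
  fixes a b \<mu> :: real and L :: "real \<Rightarrow> real \<Rightarrow> real \<Rightarrow> real"
  assumes L_cont: "continuous_on ({a..b} \<times> UNIV \<times> UNIV) (\<lambda>(x, u, v). L x u v)"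
    and L_Holder: "locally_Holder_lagrangian L a b"
    and L_vv: "has_continuous_L_vv L a b"
    and mu_pos: "\<mu> > 0"
    and L_vv_ge: "\<And>x u v. x \<in> {a..b} \<Longrightarrow> L_vv L x u v \<ge> \<mu>"
begin

lemma L_Taylor:
  assumes "x \<in> {a..b}"
  shows "\<exists>\<xi>. \<bar>\<xi>\<bar> \<le> max \<bar>s\<bar> \<bar>v\<bar> \<and>
    L x y v = L x y s + deriv (L x y) s * (v - s) + L_vv L x y \<xi> / 2 * (v - s)\<^sup>2"
proof (rule Taylor_second_order)
  show "(L x y has_real_derivative deriv (L x y) v) (at v)" for v
    using L_vv assms unfolding has_continuous_L_vv_def by (simp add: DERIV_deriv_iff_field_differentiable)
  show "(deriv (L x y) has_real_derivative L_vv L x y v) (at v)" for v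
    using L_vv assms unfolding has_continuous_L_vv_def L_vv_def
    by (simp add: DERIV_deriv_iff_field_differentiable)
qed

lemma L_ge_tangent:
  assumes "x \<in> {a..b}"
  shows "L x y v \<ge> L x y s + deriv (L x y) s * (v - s) + \<mu> / 2 * (v - s)\<^sup>2"
proof -
  obtain \<xi> where "L x y v = L x y s + deriv (L x y) s * (v - s) + L_vv L x y \<xi> / 2 * (v - s)\<^sup>2"
    using L_Taylor[OF assms] by blast
  moreover have "\<mu> / 2 * (v - s)\<^sup>2 \<le> L_vv L x y \<xi> / 2 * (v - s)\<^sup>2"
    using L_vv_ge[OF assms] by (intro mult_right_mono) auto
  ultimately show ?thesis by linarith
qed

lemma L_bounded:
  obtains C where "C \<ge> 0" "\<And>x y v. x \<in> {a..b} \<Longrightarrow> \<bar>y\<bar> \<le> R \<Longrightarrow> \<bar>v\<bar> \<le> K \<Longrightarrow> \<bar>L x y v\<bar> \<le> C"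
proof -
  have "compact ({a..b} \<times> {-R..R} \<times> {-K..K})" by (intro compact_Times compact_Icc)
  moreover have "continuous_on ({a..b} \<times> {-R..R} \<times> {-K..K}) (\<lambda>(x, u, v). L x u v)"
    by (rule continuous_on_subset[OF L_cont]) auto
  ultimately obtain C where C: "C \<ge> 0"
    "\<And>z. z \<in> {a..b} \<times> {-R..R} \<times> {-K..K} \<Longrightarrow> \<bar>(\<lambda>(x, u, v). L x u v) z\<bar> \<le> C"
    by (rule abs_bounded_on_compact) blast
  show thesis
  proof (rule that[OF C(1)])
    fix x y v assume "x \<in> {a..b}" "\<bar>y\<bar> \<le> R" "\<bar>v\<bar> \<le> K"
    then show "\<bar>L x y v\<bar> \<le> C" using C(2)[of "(x, y, v)"] by (simp add: abs_le_iff)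
  qed
qed

lemma L_vv_bounded:
  obtains \<Lambda> where "\<Lambda> \<ge> 0" "\<And>x y v. x \<in> {a..b} \<Longrightarrow> \<bar>y\<bar> \<le> R \<Longrightarrow> \<bar>v\<bar> \<le> K \<Longrightarrow> L_vv L x y v \<le> \<Lambda>"
proof -
  have "compact ({a..b} \<times> {-R..R} \<times> {-K..K})" by (intro compact_Times compact_Icc)
  moreover have "continuous_on ({a..b} \<times> {-R..R} \<times> {-K..K}) (\<lambda>(x, u, v). L_vv L x u v)"
    by (rule continuous_on_subset[of "{a..b} \<times> UNIV \<times> UNIV"])
      (use L_vv in \<open>auto simp: has_continuous_L_vv_def\<close>)
  ultimately obtain C where C: "C \<ge> 0"
    "\<And>z. z \<in> {a..b} \<times> {-R..R} \<times> {-K..K} \<Longrightarrow> \<bar>(\<lambda>(x, u, v). L_vv L x u v) z\<bar> \<le> C"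
    by (rule abs_bounded_on_compact) blast
  show thesis
  proof (rule that[OF C(1)])
    fix x y v assume "x \<in> {a..b}" "\<bar>y\<bar> \<le> R" "\<bar>v\<bar> \<le> K"
    then show "L_vv L x y v \<le> C" using C(2)[of "(x, y, v)"] by (simp add: abs_le_iff)
  qed
qed

text \<open>Convexity puts \<open>L\<close> above its tangent at velocity \<open>0\<close>, and the
  values at velocities \<open>1\<close> and \<open>-1\<close> bound the slope of that tangent. Since
  the growth is linear, the negative part of \<open>L\<close> is integrable along every primitive,
  which rules out \<open>\<infinity> - \<infinity>\<close> in the action.\<close>

lemma L_lower_bound:
  obtains C where "C \<ge> 0" "\<And>x y v. x \<in> {a..b} \<Longrightarrow> \<bar>y\<bar> \<le> R \<Longrightarrow> L x y v \<ge> - C * (1 + \<bar>v\<bar>)"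
proof -
  obtain C where C: "C \<ge> 0" "\<And>x y v. x \<in> {a..b} \<Longrightarrow> \<bar>y\<bar> \<le> R \<Longrightarrow> \<bar>v\<bar> \<le> 1 \<Longrightarrow> \<bar>L x y v\<bar> \<le> C"
    using L_bounded[of R 1] by blast
  have "L x y v \<ge> - (2 * C) * (1 + \<bar>v\<bar>)" if x: "x \<in> {a..b}" "\<bar>y\<bar> \<le> R" for x y v
  proof -
    define D where "D = deriv (L x y) 0"
    have tan: "L x y w \<ge> L x y 0 + D * w" for w
    proof -
      have "\<mu> / 2 * (w - 0)\<^sup>2 \<ge> 0" using mu_pos by simp
      then show ?thesis using L_ge_tangent[OF x(1), of y 0 w] by (simp add: D_def)
    qed
    have "\<bar>D\<bar> \<le> 2 * C"
      using tan[of 1] tan[of "-1"] C(2)[OF x, of 0] C(2)[OF x, of 1] C(2)[OF x, of "-1"] by simp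
    then have "\<bar>D * v\<bar> \<le> 2 * C * \<bar>v\<bar>"
      unfolding abs_mult by (rule mult_right_mono) simp
    then show ?thesis
      using tan[of v] C(1) C(2)[OF x, of 0] by (simp add: algebra_simps)
  qed
  then show thesis using that[of "2 * C"] C(1) by simp
qed

text \<open>
  The Hoelder continuity of \<open>deriv (L x y)\<close> in \<open>(x, y)\<close> is obtained by interpolation between the
  Hoelder bound on \<open>L\<close> and the bound on \<open>L_vv\<close>: compare difference quotients with
  step \<open>d powr (\<alpha> / 2)\<close>.
\<close>

lemma L_frozen:
  assumes "K \<ge> 0"
  obtains C \<alpha> where "C \<ge> 0" "\<alpha> > 0"
    "\<And>x y p q s v. \<lbrakk>x \<in> {a..b}; p \<in> {a..b}; \<bar>y\<bar> \<le> R; \<bar>q\<bar> \<le> R; \<bar>s\<bar> \<le> K; \<bar>x - p\<bar> + \<bar>y - q\<bar> \<le> 1\<rbrakk> \<Longrightarrow>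
       L p q s + deriv (L p q) s * (v - s) + \<mu> / 4 * (v - s)\<^sup>2 - C * (\<bar>x - p\<bar> + \<bar>y - q\<bar>) powr \<alpha> \<le> L x y v"
    "\<And>x y p q s v. \<lbrakk>x \<in> {a..b}; p \<in> {a..b}; \<bar>y\<bar> \<le> R; \<bar>q\<bar> \<le> R; \<bar>s\<bar> \<le> K; \<bar>v\<bar> \<le> K; \<bar>x - p\<bar> + \<bar>y - q\<bar> \<le> 1\<rbrakk> \<Longrightarrow>
       L x y v \<le> L p q s + deriv (L p q) s * (v - s) + C * (v - s)\<^sup>2 + C * (\<bar>x - p\<bar> + \<bar>y - q\<bar>) powr \<alpha>"
proof -
  \<comment> \<open>Velocities range up to \<open>K + 1\<close> because the difference quotients
    below step from \<open>s\<close> to \<open>s + t\<close> with \<open>t \<le> 1\<close>.\<close>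
  define G where "G = {a..b} \<times> {-R..R} \<times> {-(K + 1)..K + 1}"
  have "compact G" "G \<subseteq> {a..b} \<times> UNIV \<times> UNIV"
    unfolding G_def by (intro compact_Times compact_Icc) auto
  with L_Holder obtain C1 \<alpha> where C1: "C1 > 0" "\<alpha> > 0"
    "\<forall>(x1, u1, v1)\<in>G. \<forall>(x2, u2, v2)\<in>G.
       \<bar>L x1 u1 v1 - L x2 u2 v2\<bar> \<le> C1 * (\<bar>x1 - x2\<bar> + \<bar>u1 - u2\<bar> + \<bar>v1 - v2\<bar>) powr \<alpha>"
    unfolding locally_Holder_lagrangian_def by meson
  have Hol: "\<bar>L x y v - L p q v\<bar> \<le> C1 * (\<bar>x - p\<bar> + \<bar>y - q\<bar>) powr \<alpha>"
    if "x \<in> {a..b}" "p \<in> {a..b}" "\<bar>y\<bar> \<le> R" "\<bar>q\<bar> \<le> R" "\<bar>v\<bar> \<le> K + 1" for x y p q v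
  proof -
    have "(x, y, v) \<in> G" "(p, q, v) \<in> G" using that by (auto simp: G_def)
    with C1(3) show ?thesis by fastforce
  qed
  obtain \<Lambda> where \<Lambda>: "\<Lambda> \<ge> 0" "\<And>x y v. x \<in> {a..b} \<Longrightarrow> \<bar>y\<bar> \<le> R \<Longrightarrow> \<bar>v\<bar> \<le> K + 1 \<Longrightarrow> L_vv L x y v \<le> \<Lambda>"
    using L_vv_bounded[of R "K + 1"] by blast
  \<comment> \<open>Two Hoelder errors \<open>C1 * t\<^sup>2\<close> and a remainder at most
    \<open>\<Lambda> * t\<^sup>2\<close>, to be divided by the step \<open>t\<close>.\<close>
  define C2 where "C2 = 2 * C1 + \<Lambda>"
  have C2: "C2 \<ge> 0" using C1 \<Lambda> by (simp add: C2_def)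
  have dif: "\<bar>deriv (L x y) s - deriv (L p q) s\<bar> \<le> C2 * t"
    if xp: "x \<in> {a..b}" "p \<in> {a..b}" "\<bar>y\<bar> \<le> R" "\<bar>q\<bar> \<le> R" "\<bar>s\<bar> \<le> K"
      and t: "0 < t" "t \<le> 1" "(\<bar>x - p\<bar> + \<bar>y - q\<bar>) powr \<alpha> = t\<^sup>2" for x y p q s t
  proof -
    obtain \<xi> where \<xi>: "\<bar>\<xi>\<bar> \<le> max \<bar>s\<bar> \<bar>s + t\<bar>"
      "L x y (s + t) = L x y s + deriv (L x y) s * t + L_vv L x y \<xi> / 2 * t\<^sup>2"
      using L_Taylor[OF xp(1), of s "s + t" y] by auto
    obtain \<zeta> where \<zeta>: "\<bar>\<zeta>\<bar> \<le> max \<bar>s\<bar> \<bar>s + t\<bar>"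
      "L p q (s + t) = L p q s + deriv (L p q) s * t + L_vv L p q \<zeta> / 2 * t\<^sup>2"
      using L_Taylor[OF xp(2), of s "s + t" q] by auto
    have "max \<bar>s\<bar> \<bar>s + t\<bar> \<le> K + 1" using xp(5) t by auto
    then have le: "\<bar>\<xi>\<bar> \<le> K + 1" "\<bar>\<zeta>\<bar> \<le> K + 1" using \<xi>(1) \<zeta>(1) by linarith+
    \<comment> \<open>Both values lie between \<open>\<mu> > 0\<close> and \<open>\<Lambda>\<close>,
      so uniform convexity gives the bound from below.\<close>
    have vv: "\<bar>L_vv L x y \<xi> - L_vv L p q \<zeta>\<bar> \<le> \<Lambda>"
      using \<Lambda>(2)[OF xp(1,3) le(1)] \<Lambda>(2)[OF xp(2,4) le(2)] L_vv_ge[OF xp(1), of y \<xi>]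
        L_vv_ge[OF xp(2), of q \<zeta>] mu_pos by linarith
    have "(deriv (L x y) s - deriv (L p q) s) * t =
        (L x y (s + t) - L p q (s + t)) - (L x y s - L p q s) - (L_vv L x y \<xi> - L_vv L p q \<zeta>) / 2 * t\<^sup>2"
      using \<xi>(2) \<zeta>(2) by (simp add: algebra_simps diff_divide_distrib)
    also have "\<bar>\<dots>\<bar> \<le> C1 * t\<^sup>2 + C1 * t\<^sup>2 + \<Lambda> * t\<^sup>2"
    proof -
      have "\<bar>L x y (s + t) - L p q (s + t)\<bar> \<le> C1 * t\<^sup>2" "\<bar>L x y s - L p q s\<bar> \<le> C1 * t\<^sup>2"
        using Hol[of x p y q "s + t"] Hol[of x p y q s] xp t by auto
      moreover have "\<bar>(L_vv L x y \<xi> - L_vv L p q \<zeta>) / 2 * t\<^sup>2\<bar> \<le> \<Lambda> * t\<^sup>2"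
        using mult_right_mono[OF vv zero_le_power2[of t]] mult_nonneg_nonneg[OF \<Lambda>(1) zero_le_power2[of t]]
        by (simp add: abs_mult)
      ultimately show ?thesis by linarith
    qed
    also have "\<dots> = C2 * t * t" by (simp add: C2_def power2_eq_square algebra_simps)
    finally have "\<bar>deriv (L x y) s - deriv (L p q) s\<bar> * t \<le> C2 * t * t"
      using t by (simp add: abs_mult)
    then show ?thesis using t by simp
  qed
  \<comment> \<open>Large enough for both estimates: the lower one needs
    \<open>C1 + C2\<^sup>2 / \<mu>\<close>, the upper one \<open>C1 + C2\<^sup>2\<close> and
    \<open>\<Lambda> + 1\<close>.\<close>
  define C where "C = C1 + C2\<^sup>2 + C2\<^sup>2 / \<mu> + \<Lambda> + 1"
  have key: "\<bar>(L x y s + deriv (L x y) s * (v - s)) - (L p q s + deriv (L p q) s * (v - s))\<bar>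
      \<le> C1 * t\<^sup>2 + C2 * t * \<bar>v - s\<bar>"
    if xp: "x \<in> {a..b}" "p \<in> {a..b}" "\<bar>y\<bar> \<le> R" "\<bar>q\<bar> \<le> R" "\<bar>s\<bar> \<le> K" "\<bar>x - p\<bar> + \<bar>y - q\<bar> \<le> 1"
      and t: "t = (\<bar>x - p\<bar> + \<bar>y - q\<bar>) powr (\<alpha> / 2)" for x y p q s v t
  proof (cases "\<bar>x - p\<bar> + \<bar>y - q\<bar> = 0")
    case True
    then have "x = p" "y = q" by auto
    then show ?thesis using C1 by (simp add: t)
  next
    case False
    then have pos: "0 < \<bar>x - p\<bar> + \<bar>y - q\<bar>" by auto
    then have t0: "0 < t" unfolding t by simp
    have t1: "t \<le> 1" unfolding t using C1 xp(6) by (intro powr_le1) auto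
    have t2: "(\<bar>x - p\<bar> + \<bar>y - q\<bar>) powr \<alpha> = t\<^sup>2"
      unfolding t power2_eq_square by (simp flip: powr_add)
    have "\<bar>(deriv (L x y) s - deriv (L p q) s) * (v - s)\<bar> \<le> C2 * t * \<bar>v - s\<bar>"
      unfolding abs_mult using dif[OF xp(1-5) t0 t1 t2] by (rule mult_right_mono) simp
    moreover have "\<bar>L x y s - L p q s\<bar> \<le> C1 * t\<^sup>2"
      using Hol[of x p y q s] xp t2 by auto
    ultimately show ?thesis by (simp add: algebra_simps)
  qed
  have sq: "(\<bar>x - p\<bar> + \<bar>y - q\<bar>) powr \<alpha> = ((\<bar>x - p\<bar> + \<bar>y - q\<bar>) powr (\<alpha> / 2))\<^sup>2" for x y p q :: real
    unfolding power2_eq_square by (simp flip: powr_add)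
  show thesis
  proof (rule that[of C \<alpha>])
    show "C \<ge> 0" "\<alpha> > 0" using C1 \<Lambda> mu_pos by (auto simp: C_def)
    fix x y p q s v
    assume xp: "x \<in> {a..b}" "p \<in> {a..b}" "\<bar>y\<bar> \<le> R" "\<bar>q\<bar> \<le> R" "\<bar>s\<bar> \<le> K" "\<bar>x - p\<bar> + \<bar>y - q\<bar> \<le> 1"
    define t where "t = (\<bar>x - p\<bar> + \<bar>y - q\<bar>) powr (\<alpha> / 2)"
    have k: "\<bar>(L x y s + deriv (L x y) s * (v - s)) - (L p q s + deriv (L p q) s * (v - s))\<bar>
        \<le> C1 * t\<^sup>2 + C2 * t * \<bar>v - s\<bar>"
      by (rule key[OF xp t_def])
    \<comment> \<open>Young's inequality weighted so that the error linear in \<open>v - s\<close>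
      consumes exactly half of the quadratic term of \<open>L_ge_tangent\<close>.\<close>
    have "0 \<le> (\<mu> / 2 * \<bar>v - s\<bar> - C2 * t)\<^sup>2 / \<mu>" using mu_pos by simp
    also have "\<dots> = \<mu> / 4 * (v - s)\<^sup>2 - C2 * t * \<bar>v - s\<bar> + C2\<^sup>2 / \<mu> * t\<^sup>2"
      using mu_pos by (simp add: power2_diff power_mult_distrib field_simps power2_eq_square)
    finally have young: "C2 * t * \<bar>v - s\<bar> \<le> \<mu> / 4 * (v - s)\<^sup>2 + C2\<^sup>2 / \<mu> * t\<^sup>2" by linarith
    have "(C1 + C2\<^sup>2 / \<mu>) * t\<^sup>2 \<le> C * t\<^sup>2"
      using C1 \<Lambda> mu_pos by (intro mult_right_mono) (auto simp: C_def)
    then show "L p q s + deriv (L p q) s * (v - s) + \<mu> / 4 * (v - s)\<^sup>2 - C * (\<bar>x - p\<bar> + \<bar>y - q\<bar>) powr \<alpha> \<le> L x y v"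
      using k young L_ge_tangent[OF xp(1), of y s v] unfolding sq t_def[symmetric]
      by (simp add: algebra_simps abs_le_iff)
    \<comment> \<open>Only from here on is \<open>v\<close> bounded: \<open>L_vv\<close> has a
      global lower bound, but an upper bound only on compact sets.\<close>
    assume v: "\<bar>v\<bar> \<le> K"
    obtain \<xi> where \<xi>: "\<bar>\<xi>\<bar> \<le> max \<bar>s\<bar> \<bar>v\<bar>"
      "L x y v = L x y s + deriv (L x y) s * (v - s) + L_vv L x y \<xi> / 2 * (v - s)\<^sup>2"
      using L_Taylor[OF xp(1)] by blast
    have "\<bar>\<xi>\<bar> \<le> K + 1" using \<xi>(1) xp(5) v by linarith
    then have "L_vv L x y \<xi> \<le> \<Lambda>" by (rule \<Lambda>(2)[OF xp(1,3)])
    then have "L_vv L x y \<xi> / 2 * (v - s)\<^sup>2 \<le> \<Lambda> * (v - s)\<^sup>2"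
      using \<Lambda>(1) by (intro mult_right_mono) auto
    moreover have "C2 * t * \<bar>v - s\<bar> \<le> C2\<^sup>2 * t\<^sup>2 + (v - s)\<^sup>2"
    proof -
      have "2 * (C2 * t) * \<bar>v - s\<bar> \<le> (C2 * t)\<^sup>2 + \<bar>v - s\<bar>\<^sup>2"
        by (rule sum_squares_bound)
      moreover have "0 \<le> (C2 * t)\<^sup>2 + \<bar>v - s\<bar>\<^sup>2" by simp
      ultimately have "C2 * t * \<bar>v - s\<bar> \<le> (C2 * t)\<^sup>2 + \<bar>v - s\<bar>\<^sup>2" by linarith
      then show ?thesis by (simp only: power2_abs power_mult_distrib)
    qed
    moreover have "(C1 + C2\<^sup>2) * t\<^sup>2 \<le> C * t\<^sup>2" "(\<Lambda> + 1) * (v - s)\<^sup>2 \<le> C * (v - s)\<^sup>2"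
      using C1 \<Lambda> mu_pos by (auto intro!: mult_right_mono simp: C_def)
    ultimately show "L x y v \<le> L p q s + deriv (L p q) s * (v - s) + C * (v - s)\<^sup>2 + C * (\<bar>x - p\<bar> + \<bar>y - q\<bar>) powr \<alpha>"
      using k \<xi>(2) unfolding sq t_def[symmetric]
      by (simp add: algebra_simps abs_le_iff)
  qed
qed

end

section \<open>Competitors between the obstacles\<close>

lemma C1_HolderE:
  assumes "f \<in> C1_Holder \<sigma> a b"
  obtains f' C where "\<And>x. x \<in> {a..b} \<Longrightarrow> (f has_real_derivative f' x) (at x within {a..b})"
    "continuous_on {a..b} f'" "C \<ge> 0" "\<And>x y. x \<in> {a..b} \<Longrightarrow> y \<in> {a..b} \<Longrightarrow> \<bar>f' x - f' y\<bar> \<le> C * \<bar>x - y\<bar> powr \<sigma>"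
    "\<And>x. x \<in> {a..b} \<Longrightarrow> \<bar>f' x\<bar> \<le> C" "\<And>x. x \<in> {a..b} \<Longrightarrow> \<bar>f x\<bar> \<le> C"
    "\<And>x y. x \<in> {a..b} \<Longrightarrow> y \<in> {a..b} \<Longrightarrow> \<bar>f x - f y\<bar> \<le> C * \<bar>x - y\<bar>"
proof -
  obtain f' C where f': "\<And>x. x \<in> {a..b} \<Longrightarrow> (f has_real_derivative f' x) (at x within {a..b})"
    "continuous_on {a..b} f'" "\<And>x y. x \<in> {a..b} \<Longrightarrow> y \<in> {a..b} \<Longrightarrow> \<bar>f' x - f' y\<bar> \<le> C * \<bar>x - y\<bar> powr \<sigma>"
    using assms unfolding C1_Holder_def by blast
  have cf: "continuous_on {a..b} f"
    using f'(1) by (meson DERIV_continuous continuous_on_eq_continuous_within)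
  obtain B1 where B1: "\<And>x. x \<in> {a..b} \<Longrightarrow> \<bar>f' x\<bar> \<le> B1"
    using abs_bounded_on_compact[OF compact_Icc f'(2)] by blast
  obtain B2 where B2: "\<And>x. x \<in> {a..b} \<Longrightarrow> \<bar>f x\<bar> \<le> B2"
    using abs_bounded_on_compact[OF compact_Icc cf] by blast
  define C' where "C' = max (max C 0) (max B1 B2)"
  have Lip: "\<bar>f x - f y\<bar> \<le> C' * \<bar>x - y\<bar>" if "x \<in> {a..b}" "y \<in> {a..b}" for x y
  proof -
    have "norm (f x - f y) \<le> C' * norm (x - y)"
    proof (rule field_differentiable_bound[of "{a..b}" f f'])
      show "norm (f' z) \<le> C'" if "z \<in> {a..b}" for z
        using B1[OF that] by (simp add: C'_def)
    qed (use f'(1) that in auto)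
    then show ?thesis by simp
  qed
  show thesis
  proof (rule that[OF f'(1,2)])
    fix x y assume xy: "x \<in> {a..b}" "y \<in> {a..b}"
    have "C * \<bar>x - y\<bar> powr \<sigma> \<le> C' * \<bar>x - y\<bar> powr \<sigma>"
      by (intro mult_right_mono) (auto simp: C'_def)
    then show "\<bar>f' x - f' y\<bar> \<le> C' * \<bar>x - y\<bar> powr \<sigma>" using f'(3)[OF xy] by linarith
  next
    show "\<bar>f' x\<bar> \<le> C'" if "x \<in> {a..b}" for x using B1[OF that] by (auto simp: C'_def)
    show "\<bar>f x\<bar> \<le> C'" if "x \<in> {a..b}" for x using B2[OF that] by (auto simp: C'_def)
  qed (use Lip in \<open>auto simp: C'_def\<close>)
qed

definition obstacle_curve ::
    "(real \<Rightarrow> real) \<Rightarrow> (real \<Rightarrow> real) \<Rightarrow> real \<Rightarrow> real \<Rightarrow> real \<Rightarrow> real \<Rightarrow> real \<Rightarrow> (real \<Rightarrow> real) \<Rightarrow> (real \<Rightarrow> real) \<Rightarrow> bool" where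
  "obstacle_curve f g x1 x2 y1 y2 \<kappa> w w' \<longleftrightarrow>
     (\<forall>x\<in>{x1..x2}. (w has_real_derivative w' x) (at x within {x1..x2})) \<and>
     continuous_on {x1..x2} w' \<and> w x1 = y1 \<and> w x2 = y2 \<and>
     (\<forall>x\<in>{x1..x2}. f x \<le> w x \<and> w x \<le> g x) \<and>
     (\<forall>x\<in>{x1..x2}. \<bar>w' x - (y2 - y1) / (x2 - x1)\<bar> \<le> \<kappa>)"

text \<open>
  The competitor is \<open>f + \<lambda> * (g - f)\<close> with \<open>\<lambda>\<close> affine, so the obstacle conditions
  reduce to \<open>0 \<le> \<lambda> \<le> 1\<close>, which need only be checked at the end points.
\<close>

lemma obstacle_competitor:
  assumes f: "f \<in> C1_Holder \<sigma> a b" and g: "g \<in> C1_Holder \<sigma> a b" and fg: "\<And>x. x \<in> {a..b} \<Longrightarrow> f x < g x"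
    and \<sigma>: "0 < \<sigma>" "\<sigma> \<le> 1" and ab: "a < b" and M: "M \<ge> 0"
  obtains K where "K \<ge> 0"
    "\<And>x1 x2 y1 y2. \<lbrakk>a \<le> x1; x1 < x2; x2 \<le> b; f x1 \<le> y1; y1 \<le> g x1; f x2 \<le> y2; y2 \<le> g x2;
       \<bar>y2 - y1\<bar> \<le> M * (x2 - x1)\<rbrakk> \<Longrightarrow>
       \<exists>w w'. obstacle_curve f g x1 x2 y1 y2 (K * (x2 - x1) powr \<sigma>) w w'"
proof -
  obtain f' Cf where f': "\<And>x. x \<in> {a..b} \<Longrightarrow> (f has_real_derivative f' x) (at x within {a..b})"
    "continuous_on {a..b} f'" "Cf \<ge> 0" "\<And>x y. x \<in> {a..b} \<Longrightarrow> y \<in> {a..b} \<Longrightarrow> \<bar>f' x - f' y\<bar> \<le> Cf * \<bar>x - y\<bar> powr \<sigma>"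
    "\<And>x. x \<in> {a..b} \<Longrightarrow> \<bar>f' x\<bar> \<le> Cf"
    "\<And>x y. x \<in> {a..b} \<Longrightarrow> y \<in> {a..b} \<Longrightarrow> \<bar>f x - f y\<bar> \<le> Cf * \<bar>x - y\<bar>"
    using C1_HolderE[OF f] by metis
  obtain g' Cg where g': "\<And>x. x \<in> {a..b} \<Longrightarrow> (g has_real_derivative g' x) (at x within {a..b})"
    "continuous_on {a..b} g'" "Cg \<ge> 0" "\<And>x y. x \<in> {a..b} \<Longrightarrow> y \<in> {a..b} \<Longrightarrow> \<bar>g' x - g' y\<bar> \<le> Cg * \<bar>x - y\<bar> powr \<sigma>"
    "\<And>x. x \<in> {a..b} \<Longrightarrow> \<bar>g' x\<bar> \<le> Cg"
    "\<And>x y. x \<in> {a..b} \<Longrightarrow> y \<in> {a..b} \<Longrightarrow> \<bar>g x - g y\<bar> \<le> Cg * \<bar>x - y\<bar>"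
    using C1_HolderE[OF g] by metis
  define C where "C = Cf + Cg"
  define d where "d x = g x - f x" for x
  define d' where "d' x = g' x - f' x" for x
  have C: "C \<ge> 0" "Cf \<le> C" using f'(3) g'(3) by (auto simp: C_def)
  have dC: "\<bar>d x - d y\<bar> \<le> C * \<bar>x - y\<bar>" "\<bar>d' x - d' y\<bar> \<le> C * \<bar>x - y\<bar> powr \<sigma>" "\<bar>d' x\<bar> \<le> C"
    if "x \<in> {a..b}" "y \<in> {a..b}" for x y
    using f'(4,6)[OF that] f'(5)[OF that(1)] g'(4,6)[OF that] g'(5)[OF that(1)]
    unfolding d_def d'_def C_def distrib_right by linarith+
  have fC: "\<bar>f x - f y\<bar> \<le> C * \<bar>x - y\<bar>" "\<bar>f' x - f' y\<bar> \<le> C * \<bar>x - y\<bar> powr \<sigma>"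
    if "x \<in> {a..b}" "y \<in> {a..b}" for x y
    by (rule order_trans[OF f'(6)[OF that] mult_right_mono[OF C(2) abs_ge_zero]],
        rule order_trans[OF f'(4)[OF that] mult_right_mono[OF C(2) powr_ge_zero]])
  have cd: "continuous_on {a..b} d"
    unfolding d_def using f'(1) g'(1)
    by (intro continuous_on_diff) (meson DERIV_continuous continuous_on_eq_continuous_within)+
  have "{a..b} \<noteq> {}" using ab by simp
  then obtain x0 where x0: "x0 \<in> {a..b}" "\<And>x. x \<in> {a..b} \<Longrightarrow> d x0 \<le> d x"
    using continuous_attains_inf[OF compact_Icc _ cd] by blast
  define \<delta> where "\<delta> = d x0"
  have \<delta>: "\<delta> > 0" "\<And>x. x \<in> {a..b} \<Longrightarrow> \<delta> \<le> d x" using fg[OF x0(1)] x0 by (auto simp: d_def \<delta>_def)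
  \<comment> \<open>A Lipschitz bound for the affine weight: \<open>\<delta>\<close> is the smallest
    gap between the obstacles, and the change of the weight times the gap is at most
    \<open>(M + 2 * C) * h\<close>.\<close>
  define Q where "Q = (M + 2 * C) / \<delta>"
  have Q: "Q \<ge> 0" using M C \<delta> by (simp add: Q_def)
  \<comment> \<open>\<open>2 * C\<close> comes from the Hoelder oscillation of \<open>f'\<close> and
    \<open>d'\<close>; the two terms \<open>Q * C * h\<close> come from the oscillation of
    \<open>d\<close> and of the weight, converted by
    \<open>h \<le> (1 + (b - a)) * h powr \<sigma>\<close>.\<close>
  define K where "K = 2 * C + 2 * (Q * C * (1 + (b - a)))"
  show thesis
  proof (rule that[of K])
    show "K \<ge> 0" using C Q ab by (simp add: K_def)
    fix x1 x2 y1 y2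
    assume x: "a \<le> x1" "x1 < x2" "x2 \<le> b" and y: "f x1 \<le> y1" "y1 \<le> g x1" "f x2 \<le> y2" "y2 \<le> g x2"
      and s: "\<bar>y2 - y1\<bar> \<le> M * (x2 - x1)"
    define h where "h = x2 - x1"
    have h: "h > 0" "h \<le> b - a" using x by (auto simp: h_def)
    have hs: "h \<le> (1 + (b - a)) * h powr \<sigma>"
    proof (cases "h \<le> 1")
      case True
      then have "h powr 1 \<le> h powr \<sigma>" using h \<sigma> by (intro powr_mono') auto
      also have "\<dots> \<le> (1 + (b - a)) * h powr \<sigma>" using ab by (simp add: mult_le_cancel_right1)
      finally show ?thesis using h by simp
    next
      case False
      then have "1 \<le> h powr \<sigma>" using \<sigma> by (intro ge_one_powr_ge_zero) auto
      then have "(b - a) * 1 \<le> (1 + (b - a)) * h powr \<sigma>" using ab by (intro mult_mono) auto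
      then show ?thesis using h by simp
    qed
    have x12: "x1 \<in> {a..b}" "x2 \<in> {a..b}" and sub: "{x1..x2} \<subseteq> {a..b}" using x by auto
    define l1 where "l1 = (y1 - f x1) / d x1"
    define l2 where "l2 = (y2 - f x2) / d x2"
    have dpos: "d x1 > 0" "d x2 > 0" using \<delta>(2)[OF x12(1)] \<delta>(2)[OF x12(2)] \<delta>(1) by auto
    have l: "0 \<le> l1" "l1 \<le> 1" "0 \<le> l2" "l2 \<le> 1"
      using y dpos by (auto simp: l1_def l2_def d_def divide_simps)
    have ly: "y1 = f x1 + l1 * d x1" "y2 = f x2 + l2 * d x2"
      using dpos by (auto simp: l1_def l2_def)
    define k where "k = (l2 - l1) / h"
    have "\<bar>l2 - l1\<bar> * \<delta> \<le> \<bar>l2 - l1\<bar> * d x2" using \<delta>(2)[OF x12(2)] by (intro mult_left_mono) auto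
    also have "\<dots> = \<bar>(y2 - y1) - (f x2 - f x1) - l1 * (d x2 - d x1)\<bar>"
    proof -
      have "(y2 - y1) - (f x2 - f x1) - l1 * (d x2 - d x1) = (l2 - l1) * d x2"
        using ly by (simp add: algebra_simps)
      then show ?thesis using dpos by (simp add: abs_mult)
    qed
    also have "\<dots> \<le> \<bar>y2 - y1\<bar> + \<bar>f x2 - f x1\<bar> + \<bar>l1 * (d x2 - d x1)\<bar>" by linarith
    also have "\<dots> \<le> M * h + C * h + C * h"
    proof (intro add_mono)
      show "\<bar>f x2 - f x1\<bar> \<le> C * h"
        using fC(1)[OF x12(2,1)] x by (simp add: h_def)
      have "\<bar>l1 * (d x2 - d x1)\<bar> \<le> 1 * (C * h)"
        unfolding abs_mult using dC(1)[OF x12(2,1)] l x C by (intro mult_mono) (auto simp: h_def)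
      then show "\<bar>l1 * (d x2 - d x1)\<bar> \<le> C * h" by simp
    qed (use s in \<open>simp add: h_def\<close>)
    finally have lQ: "\<bar>l2 - l1\<bar> \<le> Q * h" using \<delta>(1) by (simp add: Q_def field_simps)
    then have kQ: "\<bar>k\<bar> \<le> Q" using h by (simp add: k_def field_simps)
    define lam where "lam x = l1 + k * (x - x1)" for x
    have lam1: "lam x1 = l1" "lam x2 = l2" using h by (auto simp: lam_def k_def h_def)
    have lam: "0 \<le> lam x \<and> lam x \<le> 1" if "x \<in> {x1..x2}" for x
    proof -
      define t where "t = (x - x1) / h"
      have t: "0 \<le> t" "t \<le> 1" using that h by (auto simp: t_def h_def)
      have "lam x = (1 - t) * l1 + t * l2"
        using h by (simp add: lam_def k_def t_def field_simps)
      moreover have "(1 - t) * l1 + t * l2 \<le> (1 - t) * 1 + t * 1"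
        using t l by (intro add_mono mult_left_mono) auto
      ultimately show ?thesis using t l by simp
    qed
    define w where "w x = f x + lam x * d x" for x
    define w' where "w' x = f' x + (k * d x + lam x * d' x)" for x
    have der: "(w has_real_derivative w' x) (at x within {x1..x2})" if "x \<in> {x1..x2}" for x
    proof -
      have "(f has_real_derivative f' x) (at x within {x1..x2})" "(g has_real_derivative g' x) (at x within {x1..x2})"
        using f'(1)[of x] g'(1)[of x] that sub by (auto intro: DERIV_subset)
      then show ?thesis unfolding w_def w'_def lam_def d_def d'_def
        by (auto intro!: derivative_eq_intros)
    qed
    have cw: "continuous_on {x1..x2} w'"
      unfolding w'_def lam_def d'_def
      by (intro continuous_intros continuous_on_subset[OF cd sub] continuous_on_subset[OF f'(2) sub]
          continuous_on_subset[OF g'(2) sub])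
    have wy: "w x1 = y1" "w x2 = y2" using ly lam1 by (auto simp: w_def)
    have obst: "f x \<le> w x \<and> w x \<le> g x" if "x \<in> {x1..x2}" for x
    proof -
      have "d x \<ge> 0" using \<delta>(1) \<delta>(2)[of x] that sub by force
      then have "0 \<le> lam x * d x" "lam x * d x \<le> 1 * d x"
        using lam[OF that] mult_right_mono[of "lam x" 1 "d x"] by auto
      then show ?thesis by (simp add: w_def d_def)
    qed
    \<comment> \<open>By the mean value theorem the chord slope is itself a value of
      \<open>w'\<close>, so only the oscillation of \<open>w'\<close> has to be estimated.\<close>
    obtain t where t: "t \<in> {x1<..<x2}" "w x2 - w x1 = w' t * (x2 - x1)"
      using mvt_simple[OF x(2), of w "\<lambda>x. (*) (w' x)"] der
      unfolding has_field_derivative_def by auto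
    have st: "(y2 - y1) / h = w' t" using t wy x by (simp add: h_def)
    have bnd: "\<bar>w' x - w' t\<bar> \<le> K * h powr \<sigma>" if xx: "x \<in> {x1..x2}" for x
    proof -
      have m: "x \<in> {a..b}" "t \<in> {a..b}" using xx t sub by auto
      have xt: "\<bar>x - t\<bar> \<le> h" using xx t by (auto simp: h_def)
      then have xts: "\<bar>x - t\<bar> powr \<sigma> \<le> h powr \<sigma>" using \<sigma> by (intro powr_mono2) auto
      have "w' x - w' t = (f' x - f' t) + k * (d x - d t) + lam x * (d' x - d' t) + (lam x - lam t) * d' t"
        by (simp add: w'_def algebra_simps)
      moreover have "\<bar>f' x - f' t\<bar> \<le> C * h powr \<sigma>"
        by (rule order_trans[OF fC(2)[OF m] mult_left_mono[OF xts C(1)]])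
      moreover have "\<bar>k * (d x - d t)\<bar> \<le> Q * (C * h)"
      proof -
        have "\<bar>d x - d t\<bar> \<le> C * h" using dC(1)[OF m] mult_left_mono[OF xt C(1)] by linarith
        then show ?thesis unfolding abs_mult using kQ Q by (intro mult_mono) auto
      qed
      moreover have "\<bar>lam x * (d' x - d' t)\<bar> \<le> 1 * (C * h powr \<sigma>)"
      proof -
        have "\<bar>d' x - d' t\<bar> \<le> C * h powr \<sigma>" using dC(2)[OF m] mult_left_mono[OF xts C(1)] by linarith
        then show ?thesis unfolding abs_mult using lam[OF xx] by (intro mult_mono) auto
      qed
      moreover have "\<bar>(lam x - lam t) * d' t\<bar> \<le> (Q * h) * C"
      proof -
        have "lam x - lam t = k * (x - t)" by (simp add: lam_def algebra_simps)
        then have "\<bar>lam x - lam t\<bar> \<le> Q * h"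
          using kQ xt Q by (simp add: abs_mult mult_mono)
        then show ?thesis unfolding abs_mult using dC(3)[OF m(2,1)] Q h by (intro mult_mono) auto
      qed
      moreover have "Q * C * h \<le> Q * C * ((1 + (b - a)) * h powr \<sigma>)"
        using hs Q C by (intro mult_left_mono) auto
      ultimately show ?thesis unfolding K_def by (simp add: algebra_simps)
    qed
    show "\<exists>w w'. obstacle_curve f g x1 x2 y1 y2 (K * (x2 - x1) powr \<sigma>) w w'"
      unfolding obstacle_curve_def h_def[symmetric] st
      by (rule exI[of _ w], rule exI[of _ w'], intro conjI ballI der cw wy bnd) (use obst in auto)
  qed
qed

section \<open>Minimizers\<close>

lemma absolutely_integrable_extend:
  fixes z :: "real \<Rightarrow> real"
  assumes "z absolutely_integrable_on {c..d}" "{c..d} \<subseteq> S"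
  shows "(\<lambda>x. if x \<in> {c..d} then z x else 0) absolutely_integrable_on S"
proof -
  have "(\<lambda>x. indicat_real S x *\<^sub>R (if x \<in> {c..d} then z x else 0)) = (\<lambda>x. indicat_real {c..d} x *\<^sub>R z x)"
    using assms(2) by (auto simp: indicator_def fun_eq_iff)
  then show ?thesis using assms(1) unfolding set_integrable_def by simp
qed

text \<open>The new derivative is \<open>U + Z\<close> with \<open>Z\<close> equal to
  \<open>W - U\<close> on \<open>{c..d}\<close> and zero elsewhere. As the end values agree,
  \<open>Z\<close> has integral zero over \<open>{c..d}\<close>, so nothing changes beyond
  \<open>d\<close>.\<close>

lemma is_primitive_replace:
  assumes u: "is_primitive u U a b" and w: "is_primitive w W c d" and cd: "a \<le> c" "c < d" "d \<le> b"
    and eq: "w c = u c" "w d = u d"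
  shows "is_primitive (\<lambda>x. if x \<in> {c..d} then w x else u x) (\<lambda>x. if x \<in> {c..d} then W x else U x) a b"
proof -
  define z where "z x = W x - U x" for x
  define Z where "Z x = (if x \<in> {c..d} then z x else 0)" for x
  have iz: "z absolutely_integrable_on {c..d}"
    unfolding z_def using is_primitive_integrable(1)[OF u cd(1,3)] w
    by (intro set_integral_diff) (auto simp: is_primitive_def)
  have iZ: "Z absolutely_integrable_on {a..b}"
    unfolding Z_def by (rule absolutely_integrable_extend[OF iz]) (use cd in auto)
  have iU: "U absolutely_integrable_on {a..b}" using u by (simp add: is_primitive_def)
  have eqW: "(\<lambda>x. if x \<in> {c..d} then W x else U x) = (\<lambda>x. U x + Z x)"
    by (auto simp: Z_def z_def)
  have pZ: "integral {a..x} Z = (if x \<in> {c..d} then w x - u x else 0)" if x: "x \<in> {a..b}" for x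
  proof -
    have "integral {a..x} Z = integral ({a..x} \<inter> {c..d}) z"
      unfolding Z_def integral_restrict_Int by (simp add: Int_commute)
    also have "{a..x} \<inter> {c..d} = {c..min x d}" using cd by auto
    finally have *: "integral {a..x} Z = integral {c..min x d} z" .
    show ?thesis
    proof (cases "c \<le> x")
      case True
      have m: "c \<le> min x d" "min x d \<le> d" "min x d \<le> b" using True cd by auto
      have "integral {c..min x d} z = integral {c..min x d} W - integral {c..min x d} U"
        unfolding z_def using is_primitive_integrable(2)[OF u cd(1) m(3)] is_primitive_integrable(2)[OF w order_refl m(2)]
        by (rule integral_diff[rotated])
      also have "\<dots> = (w (min x d) - w c) - (u (min x d) - u c)"
        using is_primitive_diff[OF u cd(1) m(1,3)] is_primitive_diff[OF w order_refl m(1,2)] by simp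
      finally show ?thesis using * True eq by (auto simp: min_def)
    next
      case False
      then show ?thesis using * by auto
    qed
  qed
  show ?thesis
    unfolding is_primitive_def eqW
  proof (intro conjI ballI)
    show "(\<lambda>x. U x + Z x) absolutely_integrable_on {a..b}" by (intro set_integral_add iU iZ)
    fix x assume x: "x \<in> {a..b}"
    have "Z integrable_on {a..x}"
      using absolutely_integrable_on_subinterval[OF iZ, of a x] x set_lebesgue_integral_eq_integral(1) by auto
    then have "integral {a..x} (\<lambda>x. U x + Z x) = integral {a..x} U + integral {a..x} Z"
      using is_primitive_integrable(2)[OF u, of a x] x by (intro integral_add) auto
    then have "integral {a..x} (\<lambda>x. U x + Z x) = (u x - u a) + (if x \<in> {c..d} then w x - u x else 0)"
      using is_primitive_diff[OF u, of a x] pZ[OF x] x by simp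
    moreover have "a \<in> {c..d} \<Longrightarrow> w a = u a" using cd eq by auto
    ultimately show "(if x \<in> {c..d} then w x else u x) =
        (if a \<in> {c..d} then w a else u a) + integral {a..x} (\<lambda>x. U x + Z x)" by auto
  qed
qed

text \<open>Young's inequality takes the place of Cauchy--Schwarz; the free parameter \<open>\<tau>\<close> is chosen later.\<close>

lemma primitive_affine_deviation:
  assumes u: "is_primitive u U a b" and x: "a \<le> x1" "x1 \<le> x" "x \<le> x2" "x2 \<le> b" and \<tau>: "\<tau> > 0"
    and int: "(\<lambda>x. (U x - s)\<^sup>2) integrable_on {x1..x2}"
  shows "\<bar>u x - (u x1 + s * (x - x1))\<bar> \<le> (\<tau> * (x2 - x1) + integral {x1..x2} (\<lambda>x. (U x - s)\<^sup>2) / \<tau>) / 2"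
proof -
  have iU: "U integrable_on {x1..x}" by (rule is_primitive_integrable(2)[OF u]) (use x in auto)
  have "u x - (u x1 + s * (x - x1)) = integral {x1..x} U - integral {x1..x} (\<lambda>_. s)"
    using is_primitive_diff[OF u, of x1 x] x by simp
  also have "\<dots> = integral {x1..x} (\<lambda>t. U t - s)"
    by (rule integral_diff[symmetric]) (use iU in \<open>auto intro: integrable_const_ivl\<close>)
  finally have "\<bar>u x - (u x1 + s * (x - x1))\<bar> = norm (integral {x1..x} (\<lambda>t. U t - s))" by simp
  also have "\<dots> \<le> integral {x1..x} (\<lambda>t. (\<tau> + (U t - s)\<^sup>2 / \<tau>) / 2)"
  proof (rule integral_norm_bound_integral)
    show "(\<lambda>t. U t - s) integrable_on {x1..x}"
      by (intro integrable_diff iU integrable_const_ivl)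
    have "(\<lambda>x. (U x - s)\<^sup>2) integrable_on {x1..x}"
      by (rule integrable_on_subinterval[OF int]) (use x in auto)
    then show "(\<lambda>t. (\<tau> + (U t - s)\<^sup>2 / \<tau>) / 2) integrable_on {x1..x}"
      by (intro integrable_on_divide integrable_add integrable_const_ivl)
    fix t
    have "2 * \<tau> * \<bar>U t - s\<bar> \<le> \<tau>\<^sup>2 + \<bar>U t - s\<bar>\<^sup>2" by (rule sum_squares_bound)
    then show "norm (U t - s) \<le> (\<tau> + (U t - s)\<^sup>2 / \<tau>) / 2"
      using \<tau> by (simp add: field_simps power2_eq_square)
  qed
  also have "\<dots> \<le> integral {x1..x2} (\<lambda>t. (\<tau> + (U t - s)\<^sup>2 / \<tau>) / 2)"
  proof (rule integral_subset_le)
    show i: "(\<lambda>t. (\<tau> + (U t - s)\<^sup>2 / \<tau>) / 2) integrable_on {x1..x2}"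
      using int by (intro integrable_on_divide integrable_add integrable_const_ivl)
    show "(\<lambda>t. (\<tau> + (U t - s)\<^sup>2 / \<tau>) / 2) integrable_on {x1..x}"
      by (rule integrable_on_subinterval[OF i]) (use x in auto)
  qed (use x \<tau> in auto)
  also have "\<dots> = (\<tau> * (x2 - x1) + integral {x1..x2} (\<lambda>x. (U x - s)\<^sup>2) / \<tau>) / 2"
    using int x by (simp add: integral_add integrable_on_divide integrable_const_ivl)
  finally show ?thesis .
qed

lemma enn2ereal_eq_ereal: "p \<noteq> \<infinity> \<Longrightarrow> enn2ereal p = ereal (enn2real p)"
  by (cases p) (auto simp: enn2ereal_ennreal)

section \<open>The action along primitives\<close>

context uniformly_convex_lagrangian
begin

text \<open>Nothing is known of \<open>L\<close> for \<open>x\<close> outside \<open>{a..b}\<close>.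
  Cutting it off by the indicator of the closed strip gives a Borel function on the whole space,
  which can be composed with Lebesgue measurable maps.\<close>

lemma L_comp_measurable:
  assumes "continuous_on {a..b} v" "w \<in> borel_measurable (lebesgue_on {a..b})"
  shows "(\<lambda>x. L x (v x) (w x)) \<in> borel_measurable (lebesgue_on {a..b})"
proof -
  let ?S = "{a..b} \<times> UNIV \<times> UNIV :: (real \<times> real \<times> real) set"
  have F: "(\<lambda>z. indicator ?S z *\<^sub>R (\<lambda>(x, u, v). L x u v) z) \<in> borel_measurable borel"
    by (rule borel_measurable_continuous_on_indicator[OF _ L_cont]) (auto intro!: borel_closed closed_Times)
  have "(\<lambda>x. x) \<in> borel_measurable (lebesgue_on {a..b})" "v \<in> borel_measurable (lebesgue_on {a..b})"
    using assms(1) by (auto intro!: continuous_imp_measurable_on_sets_lebesgue continuous_intros)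
  then have "(\<lambda>x. (x, v x, w x)) \<in> borel_measurable (lebesgue_on {a..b})"
    using assms(2) by (intro borel_measurable_Pair)
  from measurable_compose[OF this F]
  have "(\<lambda>x. indicator ?S (x, v x, w x) *\<^sub>R L x (v x) (w x)) \<in> borel_measurable (lebesgue_on {a..b})"
    by simp
  then show ?thesis
    by (subst measurable_cong[where g = "\<lambda>x. indicator ?S (x, v x, w x) *\<^sub>R L x (v x) (w x)"]) auto
qed

text \<open>The chosen weak derivative differs from \<open>w\<close> only on a null set, so the
  action of a competitor can be computed from its explicit derivative.\<close>

lemma action_of_primitive:
  assumes v: "is_primitive v w a b" and ab: "a < b"
  defines "h \<equiv> \<lambda>x. indicat_real {a..b} x *\<^sub>R L x (v x) (w x)"
  shows "action L v a b =
    enn2ereal (\<integral>\<^sup>+x. ennreal (h x) \<partial>lebesgue) - enn2ereal (\<integral>\<^sup>+x. ennreal (- h x) \<partial>lebesgue)"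
proof -
  have "v \<in> W11 a b" using W11_iff_is_primitive[OF ab] v by blast
  then have "negligible {x \<in> {a..b}. weak_derivative v a b x \<noteq> w x}"
    using is_primitive_unique[OF is_primitive_weak_derivative[OF ab] v] by blast
  then have ae: "AE x in lebesgue. x \<notin> {x \<in> {a..b}. weak_derivative v a b x \<noteq> w x}"
    by (intro AE_not_in) (simp add: negligible_iff_null_sets)
  have "(\<integral>\<^sup>+x\<in>{a..b}. ennreal (L x (v x) (weak_derivative v a b x)) \<partial>lebesgue) = (\<integral>\<^sup>+x. ennreal (h x) \<partial>lebesgue)"
    by (rule nn_integral_cong_AE) (use ae in eventually_elim, auto simp: h_def indicator_def)
  moreover have "(\<integral>\<^sup>+x\<in>{a..b}. ennreal (- L x (v x) (weak_derivative v a b x)) \<partial>lebesgue) =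
      (\<integral>\<^sup>+x. ennreal (- h x) \<partial>lebesgue)"
    by (rule nn_integral_cong_AE) (use ae in eventually_elim, auto simp: h_def indicator_def)
  ultimately show ?thesis unfolding action_def by simp
qed

lemma action_eq_integral:
  assumes v: "is_primitive v w a b" and ab: "a < b"
    and int: "(\<lambda>x. L x (v x) (w x)) absolutely_integrable_on {a..b}"
  shows "action L v a b = ereal (integral {a..b} (\<lambda>x. L x (v x) (w x)))"
proof -
  define h where "h x = indicat_real {a..b} x *\<^sub>R L x (v x) (w x)" for x
  have ih: "integrable lebesgue h" using int unfolding set_integrable_def h_def .
  then have fin: "(\<integral>\<^sup>+x. ennreal (h x) \<partial>lebesgue) \<noteq> \<infinity>" "(\<integral>\<^sup>+x. ennreal (- h x) \<partial>lebesgue) \<noteq> \<infinity>"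
    unfolding real_integrable_def by auto
  have "integral {a..b} (\<lambda>x. L x (v x) (w x)) = integral\<^sup>L lebesgue h"
    using set_lebesgue_integral_eq_integral(2)[OF int] unfolding set_lebesgue_integral_def h_def by simp
  also have "\<dots> = enn2real (\<integral>\<^sup>+x. ennreal (h x) \<partial>lebesgue) - enn2real (\<integral>\<^sup>+x. ennreal (- h x) \<partial>lebesgue)"
    by (rule real_lebesgue_integral_def[OF ih])
  finally show ?thesis
    using action_of_primitive[OF v ab] fin unfolding h_def by (simp add: enn2ereal_eq_ereal)
qed

text \<open>The negative part is integrable by \<open>L_lower_bound\<close>; if the positive part
  were not, the action would be \<open>\<infinity>\<close>.\<close>

lemma L_integrable_of_action:
  assumes v: "is_primitive v w a b" and ab: "a < b" and fin: "action L v a b \<le> ereal c"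
  shows "(\<lambda>x. L x (v x) (w x)) absolutely_integrable_on {a..b}"
proof -
  define h where "h x = indicat_real {a..b} x *\<^sub>R L x (v x) (w x)" for x
  have iw: "w absolutely_integrable_on {a..b}" using v by (simp add: is_primitive_def)
  have cv: "continuous_on {a..b} v" by (rule is_primitive_continuous[OF v])
  have "(\<lambda>x. L x (v x) (w x)) \<in> borel_measurable (lebesgue_on {a..b})"
    by (rule L_comp_measurable[OF cv absolutely_integrable_imp_borel_measurable[OF iw]]) simp
  then have mh: "h \<in> borel_measurable lebesgue"
    unfolding h_def by (subst borel_measurable_restrict_space_iff[symmetric]) auto
  obtain R where R: "\<And>x. x \<in> {a..b} \<Longrightarrow> \<bar>v x\<bar> \<le> R"
    using abs_bounded_on_compact[OF compact_Icc cv] by blast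
  obtain C where C: "C \<ge> 0" "\<And>x y v. x \<in> {a..b} \<Longrightarrow> \<bar>y\<bar> \<le> R \<Longrightarrow> L x y v \<ge> - C * (1 + \<bar>v\<bar>)"
    using L_lower_bound[of R] by blast
  define k where "k x = indicat_real {a..b} x *\<^sub>R (C * (1 + \<bar>w x\<bar>))" for x
  have "(\<lambda>x. C * (1 + \<bar>w x\<bar>)) absolutely_integrable_on {a..b}"
    by (intro set_integrable_mult_right set_integral_add set_integrable_abs iw) auto
  then have "integrable lebesgue k" unfolding set_integrable_def k_def .
  then have kfin: "(\<integral>\<^sup>+x. ennreal (k x) \<partial>lebesgue) \<noteq> \<infinity>" unfolding real_integrable_def by auto
  have "(\<integral>\<^sup>+x. ennreal (- h x) \<partial>lebesgue) \<le> (\<integral>\<^sup>+x. ennreal (k x) \<partial>lebesgue)"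
  proof (rule nn_integral_mono, rule ennreal_leI)
    fix x show "- h x \<le> k x"
      using C(2)[of x "v x" "w x"] R[of x] by (auto simp: h_def k_def indicator_def)
  qed
  then have N: "(\<integral>\<^sup>+x. ennreal (- h x) \<partial>lebesgue) \<noteq> \<infinity>"
    using kfin by (auto simp: top_unique)
  have P: "(\<integral>\<^sup>+x. ennreal (h x) \<partial>lebesgue) \<noteq> \<infinity>"
  proof
    assume "(\<integral>\<^sup>+x. ennreal (h x) \<partial>lebesgue) = \<infinity>"
    then have "action L v a b = \<infinity>"
      using action_of_primitive[OF v ab] N unfolding h_def by (simp add: enn2ereal_eq_ereal)
    then show False using fin by simp
  qed
  have "integrable lebesgue h" unfolding real_integrable_def using mh N P by simp
  then show ?thesis unfolding set_integrable_def h_def .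
qed

lemma L_C1_integrable:
  assumes "continuous_on {c..d} w" "continuous_on {c..d} w'" "{c..d} \<subseteq> {a..b}"
  shows "(\<lambda>x. L x (w x) (w' x)) absolutely_integrable_on {c..d}"
proof (rule absolutely_integrable_continuous_real)
  have "continuous_on {c..d} (\<lambda>x. (\<lambda>(x, u, v). L x u v) (x, w x, w' x))"
    by (rule continuous_on_compose2[OF L_cont]) (use assms in \<open>auto intro!: continuous_intros\<close>)
  then show "continuous_on {c..d} (\<lambda>x. L x (w x) (w' x))" by simp
qed

end

section \<open>Estimates for a minimizer\<close>

locale obstacle_minimizer = uniformly_convex_lagrangian +
  fixes A B \<sigma> :: real and f g u :: "real \<Rightarrow> real"
  assumes a_less_b: "a < b" and sigma: "0 < \<sigma>" "\<sigma> \<le> 1"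
    and f: "f \<in> C1_Holder \<sigma> a b" and g: "g \<in> C1_Holder \<sigma> a b"
    and f_less_g: "\<And>x. x \<in> {a..b} \<Longrightarrow> f x < g x"
    and admissible: "u \<in> admissible a b A B f g"
    and minimal: "\<And>v. v \<in> admissible a b A B f g \<Longrightarrow> action L u a b \<le> action L v a b"
begin

abbreviation U where "U \<equiv> weak_derivative u a b"

lemma u_primitive: "is_primitive u U a b"
  using admissible a_less_b by (intro is_primitive_weak_derivative) (auto simp: admissible_def)

lemma u_obstacles: "x \<in> {a..b} \<Longrightarrow> f x \<le> u x \<and> u x \<le> g x"
  and u_boundary: "u a = A" "u b = B"
  using admissible by (auto simp: admissible_def)

lemma admissible_of_primitive:
  assumes "is_primitive v w a b" "v a = A" "v b = B" "\<And>x. x \<in> {a..b} \<Longrightarrow> f x \<le> v x \<and> v x \<le> g x"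
  shows "v \<in> admissible a b A B f g"
  using assms W11_iff_is_primitive[OF a_less_b] unfolding admissible_def by blast

text \<open>Some admissible function has finite action, namely the obstacle curve over all of
  \<open>{a..b}\<close> that joins the boundary values. By minimality the action of \<open>u\<close>
  is not \<open>\<infinity>\<close>.\<close>

lemma L_u_integrable: "(\<lambda>x. L x (u x) (U x)) absolutely_integrable_on {a..b}"
proof -
  define M where "M = \<bar>B - A\<bar> / (b - a)"
  have "M \<ge> 0" using a_less_b by (simp add: M_def)
  obtain K where "K \<ge> 0" and K: "\<And>x1 x2 y1 y2. \<lbrakk>a \<le> x1; x1 < x2; x2 \<le> b; f x1 \<le> y1; y1 \<le> g x1; f x2 \<le> y2; y2 \<le> g x2;
       \<bar>y2 - y1\<bar> \<le> M * (x2 - x1)\<rbrakk> \<Longrightarrow> \<exists>w w'. obstacle_curve f g x1 x2 y1 y2 (K * (x2 - x1) powr \<sigma>) w w'"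
    using obstacle_competitor[OF f g f_less_g sigma a_less_b \<open>M \<ge> 0\<close>] by blast
  have "\<exists>w w'. obstacle_curve f g a b A B (K * (b - a) powr \<sigma>) w w'"
    by (rule K) (use a_less_b u_obstacles[of a] u_obstacles[of b] u_boundary in \<open>auto simp: M_def\<close>)
  then obtain w w' where w: "\<forall>x\<in>{a..b}. (w has_real_derivative w' x) (at x within {a..b})"
    "continuous_on {a..b} w'" "w a = A" "w b = B" "\<forall>x\<in>{a..b}. f x \<le> w x \<and> w x \<le> g x"
    unfolding obstacle_curve_def by blast
  have pw: "is_primitive w w' a b" using w by (intro is_primitiveI_C1) auto
  have "w \<in> admissible a b A B f g" using w by (intro admissible_of_primitive[OF pw]) auto
  then have "action L u a b \<le> action L w a b" by (rule minimal)
  also have "\<dots> = ereal (integral {a..b} (\<lambda>x. L x (w x) (w' x)))"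
    by (rule action_eq_integral[OF pw a_less_b L_C1_integrable]) (use is_primitive_continuous[OF pw] w in auto)
  finally show ?thesis by (rule L_integrable_of_action[OF u_primitive a_less_b])
qed

text \<open>Insert \<open>w\<close> into \<open>u\<close> on \<open>{x1..x2}\<close> and compare the
  actions over \<open>{a..b}\<close>. The common part outside cancels because it is finite.\<close>

lemma local_minimality:
  assumes x: "a \<le> x1" "x1 < x2" "x2 \<le> b" and w: "is_primitive w w' x1 x2" "continuous_on {x1..x2} w'"
    and bd: "w x1 = u x1" "w x2 = u x2" and obst: "\<And>x. x \<in> {x1..x2} \<Longrightarrow> f x \<le> w x \<and> w x \<le> g x"
  shows "integral {x1..x2} (\<lambda>x. L x (u x) (U x)) \<le> integral {x1..x2} (\<lambda>x. L x (w x) (w' x))"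
proof -
  define v where "v x = (if x \<in> {x1..x2} then w x else u x)" for x
  define V where "V x = (if x \<in> {x1..x2} then w' x else U x)" for x
  have pv: "is_primitive v V a b"
    unfolding v_def V_def by (rule is_primitive_replace[OF u_primitive w(1) x bd])
  have va: "v \<in> admissible a b A B f g"
    by (rule admissible_of_primitive[OF pv]) (use bd x obst u_obstacles u_boundary in \<open>auto simp: v_def\<close>)
  have sub: "{x1..x2} \<subseteq> {a..b}" using x by auto
  have iw: "(\<lambda>x. L x (w x) (w' x)) absolutely_integrable_on {x1..x2}"
    by (rule L_C1_integrable[OF is_primitive_continuous[OF w(1)] w(2) sub])
  have iu: "(\<lambda>x. L x (u x) (U x)) absolutely_integrable_on {x1..x2}"
    by (rule absolutely_integrable_on_subinterval[OF L_u_integrable sub])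
  define D where "D x = L x (w x) (w' x) - L x (u x) (U x)" for x
  define E where "E x = (if x \<in> {x1..x2} then D x else 0)" for x
  have iD: "D absolutely_integrable_on {x1..x2}" unfolding D_def by (intro set_integral_diff iw iu)
  have iE: "E absolutely_integrable_on {a..b}" unfolding E_def by (rule absolutely_integrable_extend[OF iD sub])
  have eq: "(\<lambda>x. L x (v x) (V x)) = (\<lambda>x. L x (u x) (U x) + E x)"
    by (auto simp: fun_eq_iff v_def V_def E_def D_def)
  have iv: "(\<lambda>x. L x (v x) (V x)) absolutely_integrable_on {a..b}"
    unfolding eq by (intro set_integral_add L_u_integrable iE)
  have "integral {a..b} (\<lambda>x. L x (u x) (U x)) \<le> integral {a..b} (\<lambda>x. L x (v x) (V x))"
    using minimal[OF va] action_eq_integral[OF pv a_less_b iv]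
      action_eq_integral[OF u_primitive a_less_b L_u_integrable] by simp
  also have "\<dots> = integral {a..b} (\<lambda>x. L x (u x) (U x)) + integral {a..b} E"
    unfolding eq by (intro integral_add set_lebesgue_integral_eq_integral(1) L_u_integrable iE)
  also have "integral {a..b} E = integral {x1..x2} D"
    unfolding E_def integral_restrict_Int using sub by (simp only: Int_absorb2)
  also have "integral {x1..x2} D = integral {x1..x2} (\<lambda>x. L x (w x) (w' x)) - integral {x1..x2} (\<lambda>x. L x (u x) (U x))"
    unfolding D_def by (intro integral_diff set_lebesgue_integral_eq_integral(1) iw iu)
  finally show ?thesis by simp
qed

text \<open>\<open>u\<close> and \<open>w\<close> have the same end values, so the affine terms have
  equal integrals. What is left is \<open>\<mu> / 4\<close> times the energy minus
  \<open>D * (x2 - x1)\<close> below \<open>D * (x2 - x1)\<close>, hence the factor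
  \<open>8 / \<mu>\<close>.\<close>

lemma energy_estimate:
  assumes x: "a \<le> x1" "x1 < x2" "x2 \<le> b" and w: "is_primitive w w' x1 x2" "continuous_on {x1..x2} w'"
    and bd: "w x1 = u x1" "w x2 = u x2" and obst: "\<And>x. x \<in> {x1..x2} \<Longrightarrow> f x \<le> w x \<and> w x \<le> g x"
    and lower: "\<And>x. x \<in> {x1..x2} \<Longrightarrow> c0 + c1 * (U x - s) + \<mu> / 4 * (U x - s)\<^sup>2 - D \<le> L x (u x) (U x)"
    and upper: "\<And>x. x \<in> {x1..x2} \<Longrightarrow> L x (w x) (w' x) \<le> c0 + c1 * (w' x - s) + D"
  shows "(\<lambda>x. (U x - s)\<^sup>2) integrable_on {x1..x2}"
    "integral {x1..x2} (\<lambda>x. (U x - s)\<^sup>2) \<le> 8 / \<mu> * D * (x2 - x1)"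
proof -
  have sub: "{x1..x2} \<subseteq> {a..b}" using x by auto
  note iU = is_primitive_integrable[OF u_primitive x(1,3)]
  note iw = is_primitive_integrable(2)[OF w(1) order_refl order_refl]
  have iL: "(\<lambda>x. L x (u x) (U x)) integrable_on {x1..x2}"
    using absolutely_integrable_on_subinterval[OF L_u_integrable sub] by (rule set_lebesgue_integral_eq_integral(1))
  have iLw: "(\<lambda>x. L x (w x) (w' x)) integrable_on {x1..x2}"
    using L_C1_integrable[OF is_primitive_continuous[OF w(1)] w(2) sub] by (rule set_lebesgue_integral_eq_integral(1))
  \<comment> \<open>\<open>lower\<close> solved for the square. This integrable majorant shows that
    \<open>U\<close>, so far only integrable, is square integrable on the interval.\<close>
  define G where "G x = 4 / \<mu> * (L x (u x) (U x) - c0 - c1 * (U x - s) + D)" for x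
  show int: "(\<lambda>x. (U x - s)\<^sup>2) integrable_on {x1..x2}"
  proof (rule measurable_bounded_by_integrable_imp_integrable_real)
    have "U \<in> borel_measurable (lebesgue_on {x1..x2})"
      by (rule absolutely_integrable_imp_borel_measurable[OF iU(1)]) simp
    then show "(\<lambda>x. (U x - s)\<^sup>2) \<in> borel_measurable (lebesgue_on {x1..x2})" by measurable
    show "G integrable_on {x1..x2}"
      unfolding G_def by (intro integrable_on_mult_right integrable_add integrable_diff iL iU(2) integrable_const_ivl)
    show "\<bar>(U x - s)\<^sup>2\<bar> \<le> G x" if "x \<in> {x1..x2}" for x
      using lower[OF that] mu_pos by (simp add: G_def field_simps)
  qed simp
  have "integral {x1..x2} (\<lambda>x. c0 + c1 * (U x - s) + \<mu> / 4 * (U x - s)\<^sup>2 - D) \<le> integral {x1..x2} (\<lambda>x. L x (u x) (U x))"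
    by (intro integral_le integrable_on_mult_right integrable_add integrable_diff iL iU(2) integrable_const_ivl int lower)
  also have "\<dots> \<le> integral {x1..x2} (\<lambda>x. L x (w x) (w' x))"
    by (rule local_minimality[OF x w bd obst])
  also have "\<dots> \<le> integral {x1..x2} (\<lambda>x. c0 + c1 * (w' x - s) + D)"
    by (intro integral_le integrable_on_mult_right integrable_add integrable_diff iLw iw integrable_const_ivl upper)
  also have "\<dots> = c0 * (x2 - x1) + c1 * (integral {x1..x2} w' - s * (x2 - x1)) + D * (x2 - x1)"
    using iw x by (simp add: integral_add integral_diff integrable_add integrable_diff integrable_on_mult_right integrable_const_ivl)
  also have "integral {x1..x2} w' = integral {x1..x2} U"
    using is_primitive_diff[OF w(1) order_refl _ order_refl] is_primitive_diff[OF u_primitive x(1) _ x(3)] x bd by simp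
  finally have "integral {x1..x2} (\<lambda>x. c0 + c1 * (U x - s) + \<mu> / 4 * (U x - s)\<^sup>2 - D) \<le>
      c0 * (x2 - x1) + c1 * (integral {x1..x2} U - s * (x2 - x1)) + D * (x2 - x1)" .
  moreover have "integral {x1..x2} (\<lambda>x. c0 + c1 * (U x - s) + \<mu> / 4 * (U x - s)\<^sup>2 - D) =
      c0 * (x2 - x1) + c1 * (integral {x1..x2} U - s * (x2 - x1)) +
      \<mu> / 4 * integral {x1..x2} (\<lambda>x. (U x - s)\<^sup>2) - D * (x2 - x1)"
    using iU(2) x int
    by (simp add: integral_add integral_diff integrable_add integrable_diff integrable_on_mult_right integrable_const_ivl)
  ultimately have "\<mu> / 4 * integral {x1..x2} (\<lambda>x. (U x - s)\<^sup>2) \<le> 2 * D * (x2 - x1)" by linarith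
  then show "integral {x1..x2} (\<lambda>x. (U x - s)\<^sup>2) \<le> 8 / \<mu> * D * (x2 - x1)"
    using mu_pos by (simp add: field_simps)
qed

text \<open>
  The energy estimate is used twice: first with the trivial bound \<open>1\<close> for the distances to the
  frozen point, which shows that these distances are \<open>O(h)\<close> on an interval of length \<open>h\<close>,
  and then with this improved bound.
\<close>

lemma affine_approximation:
  "\<exists>C \<gamma> \<epsilon>. C \<ge> 0 \<and> \<gamma> > 0 \<and> \<epsilon> > 0 \<and>
     (\<forall>x1 x2 x. a \<le> x1 \<and> x1 \<le> x \<and> x \<le> x2 \<and> x1 < x2 \<and> x2 \<le> b \<and> x2 - x1 \<le> \<epsilon> \<and> \<bar>slope u x1 x2\<bar> \<le> M \<longrightarrow>
        \<bar>u x - (u x1 + slope u x1 x2 * (x - x1))\<bar> \<le> C * (x2 - x1) powr (1 + \<gamma>))"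
proof -
  \<comment> \<open>\<open>M\<close> is arbitrary and may be negative.\<close>
  define M' where "M' = max M 0"
  have M': "M' \<ge> 0" "M \<le> M'" by (auto simp: M'_def)
  obtain K0 where K0: "K0 \<ge> 0" "\<And>x1 x2 y1 y2. \<lbrakk>a \<le> x1; x1 < x2; x2 \<le> b; f x1 \<le> y1; y1 \<le> g x1; f x2 \<le> y2; y2 \<le> g x2;
       \<bar>y2 - y1\<bar> \<le> M' * (x2 - x1)\<rbrakk> \<Longrightarrow> \<exists>w w'. obstacle_curve f g x1 x2 y1 y2 (K0 * (x2 - x1) powr \<sigma>) w w'"
    using obstacle_competitor[OF f g f_less_g sigma a_less_b M'(1)] by blast
  obtain Rf where Rf: "\<And>x. x \<in> {a..b} \<Longrightarrow> \<bar>f x\<bar> \<le> Rf" using C1_HolderE[OF f] by metis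
  obtain Rg where Rg: "\<And>x. x \<in> {a..b} \<Longrightarrow> \<bar>g x\<bar> \<le> Rg" using C1_HolderE[OF g] by metis
  define R where "R = max Rf Rg"
  have R: "\<bar>y\<bar> \<le> R" if "x \<in> {a..b}" "f x \<le> y" "y \<le> g x" for x y
    using Rf[OF that(1)] Rg[OF that(1)] that by (auto simp: R_def)
  \<comment> \<open>Bounds both the slope \<open>s\<close> and the velocity \<open>w'\<close>, which
    differ by at most \<open>K0 * h powr \<sigma> \<le> K0\<close> when
    \<open>h \<le> 1\<close>.\<close>
  define K where "K = M' + K0"
  have K: "K \<ge> 0" using M' K0 by (simp add: K_def)
  obtain C1 \<alpha> where C1: "C1 \<ge> 0" "\<alpha> > 0"
    "\<And>x y p q s v. \<lbrakk>x \<in> {a..b}; p \<in> {a..b}; \<bar>y\<bar> \<le> R; \<bar>q\<bar> \<le> R; \<bar>s\<bar> \<le> K; \<bar>x - p\<bar> + \<bar>y - q\<bar> \<le> 1\<rbrakk> \<Longrightarrow>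
       L p q s + deriv (L p q) s * (v - s) + \<mu> / 4 * (v - s)\<^sup>2 - C1 * (\<bar>x - p\<bar> + \<bar>y - q\<bar>) powr \<alpha> \<le> L x y v"
    "\<And>x y p q s v. \<lbrakk>x \<in> {a..b}; p \<in> {a..b}; \<bar>y\<bar> \<le> R; \<bar>q\<bar> \<le> R; \<bar>s\<bar> \<le> K; \<bar>v\<bar> \<le> K; \<bar>x - p\<bar> + \<bar>y - q\<bar> \<le> 1\<rbrakk> \<Longrightarrow>
       L x y v \<le> L p q s + deriv (L p q) s * (v - s) + C1 * (v - s)\<^sup>2 + C1 * (\<bar>x - p\<bar> + \<bar>y - q\<bar>) powr \<alpha>"
    using L_frozen[OF K, of R] by blast
  have "uniformly_continuous_on {a..b} u"
    by (intro compact_uniformly_continuous compact_Icc is_primitive_continuous[OF u_primitive])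
  then obtain d where d: "d > 0" "\<And>x y. x \<in> {a..b} \<Longrightarrow> y \<in> {a..b} \<Longrightarrow> \<bar>x - y\<bar> < d \<Longrightarrow> \<bar>u x - u y\<bar> < 1 / 2"
    unfolding uniformly_continuous_on_def dist_real_def by (metis half_gt_zero zero_less_one)
  define \<epsilon> where "\<epsilon> = min (d / 2) (1 / (2 * (K + 1)))"
  have \<epsilon>: "\<epsilon> > 0" using d K by (simp add: \<epsilon>_def)
  define C3 where "C3 = 8 / \<mu> * (C1 * (1 + K0\<^sup>2))"
  have C3: "C3 \<ge> 0" using C1 mu_pos by (simp add: C3_def)
  \<comment> \<open>Collects the distance in \<open>x\<close>, the rise of the chord or of the
    competitor, and the deviation of \<open>u\<close> from its chord that the first pass
    yields.\<close>
  define C5 where "C5 = 1 + K + (1 + C3)"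
  have C5: "C5 \<ge> 0" using C3 K by (simp add: C5_def)
  define \<gamma> where "\<gamma> = min (\<alpha> / 2) \<sigma>"
  have \<gamma>: "\<gamma> > 0" using C1 sigma by (simp add: \<gamma>_def)
  define C6 where "C6 = 8 / \<mu> * (C1 * (C5 powr \<alpha> + K0\<^sup>2))"
  have C6: "C6 \<ge> 0" using C1 mu_pos by (simp add: C6_def)
  have main: "\<bar>u x - (u x1 + slope u x1 x2 * (x - x1))\<bar> \<le> (1 + C6) / 2 * (x2 - x1) powr (1 + \<gamma>)"
    if A: "a \<le> x1" "x1 \<le> x" "x \<le> x2" "x1 < x2" "x2 \<le> b" "x2 - x1 \<le> \<epsilon>" "\<bar>slope u x1 x2\<bar> \<le> M" for x1 x2 x
  proof -
    define h where "h = x2 - x1"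
    define s where "s = slope u x1 x2"
    have h: "0 < h" "h \<le> \<epsilon>" using A by (auto simp: h_def)
    have hK: "h * (K + 1) \<le> 1 / 2"
    proof -
      have "h \<le> 1 / (2 * (K + 1))" using h by (simp add: \<epsilon>_def)
      then show ?thesis using K by (simp add: field_simps)
    qed
    have h1: "h + K * h \<le> 1 / 2" "h \<le> 1 / 2" "h \<le> 1"
      using hK mult_nonneg_nonneg[OF K less_imp_le[OF h(1)]] by (simp_all add: algebra_simps)
    have hd: "h < d" using h d by (simp add: \<epsilon>_def)
    have hs: "0 \<le> h powr \<sigma>" "h powr \<sigma> \<le> 1" using h h1 sigma by (auto intro: powr_le1)
    have sM: "\<bar>s\<bar> \<le> M'" "\<bar>s\<bar> \<le> K" using A M' K0 by (auto simp: s_def K_def)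
    have us: "u x2 - u x1 = s * h" using slope_eqD[of x1 x2 u] A by (simp add: s_def h_def)
    have x12: "x1 \<in> {a..b}" "x2 \<in> {a..b}" using A by auto
    have "\<exists>w w'. obstacle_curve f g x1 x2 (u x1) (u x2) (K0 * (x2 - x1) powr \<sigma>) w w'"
    proof (rule K0(2))
      have "\<bar>s\<bar> * h \<le> M' * h" using sM h by (intro mult_right_mono) auto
      then show "\<bar>u x2 - u x1\<bar> \<le> M' * (x2 - x1)" unfolding us using h by (simp add: abs_mult flip: h_def)
    qed (use A u_obstacles x12 in auto)
    then obtain w w' where w: "\<And>x. x \<in> {x1..x2} \<Longrightarrow> (w has_real_derivative w' x) (at x within {x1..x2})"
      "continuous_on {x1..x2} w'" "w x1 = u x1" "w x2 = u x2" "\<And>x. x \<in> {x1..x2} \<Longrightarrow> f x \<le> w x \<and> w x \<le> g x"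
      "\<And>x. x \<in> {x1..x2} \<Longrightarrow> \<bar>w' x - (u x2 - u x1) / (x2 - x1)\<bar> \<le> K0 * (x2 - x1) powr \<sigma>"
      unfolding obstacle_curve_def by blast
    have pw: "is_primitive w w' x1 x2" using w by (intro is_primitiveI_C1)
    have ws: "\<bar>w' t - s\<bar> \<le> K0 * h powr \<sigma>" if "t \<in> {x1..x2}" for t
      using w(6)[OF that] by (simp add: s_def slope_def h_def)
    have "K0 * h powr \<sigma> \<le> K0" using hs K0 by (simp add: mult_left_le)
    then have wK: "\<bar>w' t\<bar> \<le> K" if "t \<in> {x1..x2}" for t
      using ws[OF that] sM(1) unfolding K_def by linarith
    have wx: "\<bar>w t - u x1\<bar> \<le> K * h" if t: "t \<in> {x1..x2}" for t
    proof -
      have "norm (w t - w x1) \<le> K * norm (t - x1)"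
        by (rule field_differentiable_bound[of "{x1..x2}" w w']) (use w(1) wK t A in auto)
      also have "\<dots> \<le> K * h" using t K by (intro mult_left_mono) (auto simp: h_def)
      finally show ?thesis using w(3) by simp
    qed
    define du where "du t = \<bar>t - x1\<bar> + \<bar>u t - u x1\<bar>" for t
    define dw where "dw t = \<bar>t - x1\<bar> + \<bar>w t - u x1\<bar>" for t
    have th: "\<bar>t - x1\<bar> \<le> h" "t \<in> {a..b}" if "t \<in> {x1..x2}" for t using that A by (auto simp: h_def)
    have du1: "du t \<le> 1" if "t \<in> {x1..x2}" for t
      using th[OF that] d(2)[of t x1] x12 hd h1 unfolding du_def by force
    have dwh: "dw t \<le> h + K * h" if "t \<in> {x1..x2}" for t
      using th[OF that] wx[OF that] unfolding dw_def by linarith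
    have dw1: "dw t \<le> 1" if "t \<in> {x1..x2}" for t using dwh[OF that] h1 by linarith
    define E where "E = integral {x1..x2} (\<lambda>t. (U t - s)\<^sup>2)"
    have est: "(\<lambda>t. (U t - s)\<^sup>2) integrable_on {x1..x2} \<and> E \<le> 8 / \<mu> * (C1 * (\<delta> powr \<alpha> + (K0 * h powr \<sigma>)\<^sup>2)) * h"
      if \<delta>: "\<And>t. t \<in> {x1..x2} \<Longrightarrow> du t \<le> \<delta> \<and> dw t \<le> \<delta>" for \<delta>
    proof -
      let ?D = "C1 * (\<delta> powr \<alpha> + (K0 * h powr \<sigma>)\<^sup>2)"
      have lower: "L x1 (u x1) s + deriv (L x1 (u x1)) s * (U t - s) + \<mu> / 4 * (U t - s)\<^sup>2 - ?D \<le> L t (u t) (U t)"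
        if t: "t \<in> {x1..x2}" for t
      proof -
        have "C1 * du t powr \<alpha> \<le> C1 * \<delta> powr \<alpha>"
          using \<delta>[OF t] C1(1,2) by (intro mult_left_mono powr_mono2) (auto simp: du_def)
        moreover have "0 \<le> C1 * (K0 * h powr \<sigma>)\<^sup>2" using C1(1) by simp
        moreover have "L x1 (u x1) s + deriv (L x1 (u x1)) s * (U t - s) + \<mu> / 4 * (U t - s)\<^sup>2 - C1 * du t powr \<alpha> \<le> L t (u t) (U t)"
          unfolding du_def
          by (rule C1(3)) (use th[OF t] x12 R u_obstacles sM du1[OF t] in \<open>auto simp: du_def\<close>)
        ultimately show ?thesis unfolding distrib_left by linarith
      qed
      have upper: "L t (w t) (w' t) \<le> L x1 (u x1) s + deriv (L x1 (u x1)) s * (w' t - s) + ?D"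
        if t: "t \<in> {x1..x2}" for t
      proof -
        have "C1 * dw t powr \<alpha> \<le> C1 * \<delta> powr \<alpha>"
          using \<delta>[OF t] C1(1,2) by (intro mult_left_mono powr_mono2) (auto simp: dw_def)
        moreover have "C1 * (w' t - s)\<^sup>2 \<le> C1 * (K0 * h powr \<sigma>)\<^sup>2"
          using ws[OF t] C1(1) power2_le_iff_abs_le[of "K0 * h powr \<sigma>" "w' t - s"] K0 hs
          by (intro mult_left_mono) auto
        moreover have "L t (w t) (w' t) \<le> L x1 (u x1) s + deriv (L x1 (u x1)) s * (w' t - s) + C1 * (w' t - s)\<^sup>2 + C1 * dw t powr \<alpha>"
          unfolding dw_def
          by (rule C1(4)) (use th[OF t] x12 R u_obstacles w(5)[OF t] sM wK[OF t] dw1[OF t] in \<open>auto simp: dw_def\<close>)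
        ultimately show ?thesis unfolding distrib_left by linarith
      qed
      show ?thesis
        using energy_estimate[OF A(1,4,5) pw w(2-5) lower upper] unfolding E_def h_def by blast
    qed
    have int: "(\<lambda>t. (U t - s)\<^sup>2) integrable_on {x1..x2}" using est[of 1] du1 dw1 by blast
    have E1: "E \<le> C3 * h"
    proof -
      have "(K0 * h powr \<sigma>)\<^sup>2 \<le> K0\<^sup>2" using hs K0 by (intro power_mono) (auto simp: mult_left_le)
      then have "8 / \<mu> * (C1 * (1 powr \<alpha> + (K0 * h powr \<sigma>)\<^sup>2)) * h \<le> C3 * h"
        unfolding C3_def using C1(1) mu_pos h by (intro mult_right_mono mult_left_mono) auto
      then show ?thesis using est[of 1] du1 dw1 by fastforce
    qed
    have dev: "\<bar>u t - (u x1 + s * (t - x1))\<bar> \<le> (\<tau> * h + E / \<tau>) / 2" if "t \<in> {x1..x2}" "\<tau> > 0" for t \<tau>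
      unfolding E_def h_def by (rule primitive_affine_deviation[OF u_primitive _ _ _ _ that(2) int]) (use that A in auto)
    have d5: "du t \<le> C5 * h \<and> dw t \<le> C5 * h" if t: "t \<in> {x1..x2}" for t
    proof -
      define r where "r = s * (t - x1)"
      define m where "m = C3 * h"
      define n where "n = K * h"
      have C5h: "C5 * h = h + n + (h + m)"
        by (simp add: C5_def m_def n_def algebra_simps)
      have mn: "0 \<le> m" "0 \<le> n" using C3 K h by (simp_all add: m_def n_def)
      have "\<bar>r\<bar> \<le> n"
        unfolding r_def n_def abs_mult using sM th[OF t] K by (intro mult_mono) auto
      moreover have "\<bar>u t - (u x1 + r)\<bar> \<le> (h + m) / 2"
        using dev[OF t, of 1] E1 by (simp add: r_def m_def)
      moreover have "(h + m) / 2 \<le> h + m" using h(1) mn by simp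
      ultimately have "\<bar>u t - u x1\<bar> \<le> n + (h + m)" by linarith
      then have "du t \<le> C5 * h"
        using th(1)[OF t] h(1) mn unfolding du_def C5h by linarith
      moreover have "dw t \<le> C5 * h"
        using dwh[OF t] h(1) mn unfolding C5h n_def[symmetric] by linarith
      ultimately show ?thesis ..
    qed
    have E2: "E \<le> C6 * (h powr \<gamma>)\<^sup>2 * h"
    proof -
      have p: "h powr \<alpha> \<le> (h powr \<gamma>)\<^sup>2" "(h powr \<sigma>)\<^sup>2 \<le> (h powr \<gamma>)\<^sup>2"
        unfolding power2_eq_square using h h1 by (auto simp flip: powr_add intro!: powr_mono' simp: \<gamma>_def)
      have "(C5 * h) powr \<alpha> + (K0 * h powr \<sigma>)\<^sup>2 = C5 powr \<alpha> * h powr \<alpha> + K0\<^sup>2 * (h powr \<sigma>)\<^sup>2"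
        using C5 h by (simp add: powr_mult power_mult_distrib)
      also have "\<dots> \<le> C5 powr \<alpha> * (h powr \<gamma>)\<^sup>2 + K0\<^sup>2 * (h powr \<gamma>)\<^sup>2"
        using p by (intro add_mono mult_left_mono) auto
      finally have "8 / \<mu> * (C1 * ((C5 * h) powr \<alpha> + (K0 * h powr \<sigma>)\<^sup>2)) * h
          \<le> 8 / \<mu> * (C1 * (C5 powr \<alpha> * (h powr \<gamma>)\<^sup>2 + K0\<^sup>2 * (h powr \<gamma>)\<^sup>2)) * h"
        using C1(1) mu_pos h by (intro mult_right_mono mult_left_mono) auto
      also have "\<dots> = C6 * (h powr \<gamma>)\<^sup>2 * h" by (simp add: C6_def algebra_simps)
      finally show ?thesis using est[OF d5] by linarith
    qed
    have pos: "h powr \<gamma> > 0" using h by simp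
    \<comment> \<open>The choice \<open>\<tau> = h powr \<gamma>\<close> balances
      \<open>\<tau> * h\<close> against \<open>E / \<tau>\<close>: both are of order
      \<open>h powr (1 + \<gamma>)\<close>.\<close>
    have "E / h powr \<gamma> \<le> C6 * (h powr \<gamma>)\<^sup>2 * h / h powr \<gamma>"
      using E2 pos by (intro divide_right_mono) auto
    also have "\<dots> = C6 * (h powr \<gamma> * h)" using pos by (simp add: power2_eq_square)
    finally have "\<bar>u x - (u x1 + s * (x - x1))\<bar> \<le> (h powr \<gamma> * h + C6 * (h powr \<gamma> * h)) / 2"
      using dev[OF _ pos, of x] A by simp
    also have "\<dots> = (1 + C6) / 2 * h powr (1 + \<gamma>)" using h by (simp add: powr_add algebra_simps)
    finally show ?thesis by (simp add: s_def h_def)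
  qed
  show ?thesis
    by (rule exI[of _ "(1 + C6) / 2"], rule exI[of _ \<gamma>], rule exI[of _ \<epsilon>]) (use C6 \<gamma> \<epsilon> main in auto)
qed

end

theorem corollary2p9:
  fixes a b A B \<mu> \<sigma> :: real
    and L :: "real \<Rightarrow> real \<Rightarrow> real \<Rightarrow> real"
    and f g u :: "real \<Rightarrow> real"
  assumes "a < b"
    and "continuous_on ({a..b} \<times> UNIV \<times> UNIV) (\<lambda>(x, u, v). L x u v)"
    and "locally_Holder_lagrangian L a b"
    and "has_continuous_L_vv L a b"
    and "\<mu> > 0" and "\<forall>x\<in>{a..b}. \<forall>u v. L_vv L x u v \<ge> \<mu>"
    and "0 < \<sigma>" and "\<sigma> \<le> 1"
    and "f \<in> C1_Holder \<sigma> a b" and "g \<in> C1_Holder \<sigma> a b"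
    and "\<forall>x\<in>{a..b}. f x < g x"
    and "u \<in> admissible a b A B f g"
    and "\<forall>v\<in>admissible a b A B f g. action L u a b \<le> action L v a b"
  shows "tonelli_partial_regularity u a b"
proof -
  interpret obstacle_minimizer a b \<mu> L A B \<sigma> f g u
    using assms by unfold_locales auto
  show ?thesis
    by (rule tonelli_partial_regularity_of_slope_rigid[OF a_less_b
          slope_rigid_of_affine_approx[OF affine_approximation] is_primitive_continuous[OF u_primitive]])
qed

end
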